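(* Let $X,\hat U,\hat\Sigma,\tilde V,\Delta X,\hat B,\Delta(X^*U),\Delta B,\tilde Q,\hat Q,\hat R,\hat Y,\Delta(X\hat Q)\in\mathbb C^{n\times n}$, with $\tilde V,\tilde Q$ unitary, $\hat R$ upper triangular and $\hat\Sigma$ diagonal with positive diagonal entries in descending order, satisfy $$X=\hat U\hat\Sigma\tilde V^*+\Delta X,\qquad \|\Delta X\|_{F}\le\varepsilon_{\mathrm{SVD}}\|X\|_{F},\qquad \|\hat U^*\hat U-I\|_{F}\le\varepsilon_{\mathrm U},$$ $$\hat B=X^*\hat U+\Delta(X^*U),\qquad \|\Delta(X^*U)\|_{F}\le\sqrt n\,\gamma_n\|\hat U\|_2\|X\|_{F},$$ $$\hat B+\Delta B=\tilde Q\hat R,\qquad \|\Delta B\|_{F}\le\varepsilon_{\mathrm{qr}}\|\hat B\|_{F},\qquad \|\hat Q-\tilde Q\|_{F}\le\varepsilon_{\mathrm Q},$$ $$\hat Y=X\hat Q+\Delta(X\hat Q),\qquad \|\Delta(X\hat Q)\|_{F}\le\sqrt n\,\gamma_n\|\hat Q\|_2\|X\|_{F}.$$ Assume $$\varepsilon_{\mathrm U}\|\hat\Sigma\|_2\|\hat\Sigma^{-1}\|_2+\sqrt n\,\bigl(\varepsilon_{\mathrm{SVD}}+\sqrt n\,\gamma_n+\varepsilon_{\mathrm{qr}}+\sqrt n\,\gamma_n\varepsilon_{\mathrm{qr}}\bigr)(1+\varepsilon_{\mathrm U})\|X\|_2\|\hat\Sigma^{-1}\|_2<\sqrt{\tfrac32}-1.$$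 Then $$\operatorname{off}(\hat\Sigma^{-1}\hat Y^*\hat Y\hat\Sigma^{-1})\le\frac{2(\sqrt2+\sqrt3)+3}{1-\varepsilon_{\mathrm U}}\varepsilon_{\mathrm U}+\frac{2(\sqrt2+\sqrt3)(1+\varepsilon_{\mathrm U})}{1-\varepsilon_{\mathrm U}}\sqrt n\,\varepsilon_{\mathrm{SVD}}\|X\|_2\|\hat\Sigma^{-1}\|_2+O(\bm u+\bm u_{\mathrm{low}}^2)\|X\|_2\|\hat\Sigma^{-1}\|_2.$$ Moreover, if in addition $\|\Delta X(i,:)\|_2\le\varepsilon_{\mathrm{SVD}}\|X(i,:)\|_2$ for every $i$, then $$\operatorname{off}(\hat\Sigma^{-1}\hat Y^*\hat Y\hat\Sigma^{-1})\le\frac{2(\sqrt2+\sqrt3)+3}{1-\varepsilon_{\mathrm U}}\varepsilon_{\mathrm U}+\frac{2(\sqrt2+\sqrt3)(1+\varepsilon_{\mathrm U})}{1-\varepsilon_{\mathrm U}}\sqrt n\,\varepsilon_{\mathrm{SVD}}\|Z_r^{-1}\|_2+O(\bm u+\bm u_{\mathrm{low}}^2)\|X\|_2\|\hat\Sigma^{-1}\|_2,$$ where $X=D_rZ_r$ with $D_r$ diagonal and each row of $Z_r$ a unit vector (i.e. $Z_r$ consists of the normalized rows of $X$).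
   Context: For a square matrix $M$, $\operatorname{off}(M)=\bigl(\sum_{i}\sum_{j\ne i}|M_{ij}|^2\bigr)^{1/2}$. $M(i,:)$ is the $i$-th row, $M^*$ the conjugate transpose, $\|\cdot\|_F$ the Frobenius norm, $\|\cdot\|_2$ the spectral (or Euclidean) norm. $\bm u$ and $\bm u_{\mathrm{low}}$ are the unit round-offs of the working and of the lower precision, $0<\bm u\le\bm u_{\mathrm{low}}$, $n\bm u<1$, and $\gamma_n=n\bm u/(1-n\bm u)$. The nonnegative quantities $\varepsilon_{\mathrm{SVD}},\varepsilon_{\mathrm U}$ are functions of $n$ and $\bm u_{\mathrm{low}}$ of size $O(\bm u_{\mathrm{low}})$, with $\varepsilon_{\mathrm U}<1$; the nonnegative quantities $\varepsilon_{\mathrm{qr}},\varepsilon_{\mathrm Q}$ are functions of $n$ and $\bm u$ of size $O(\bm u)$. The matrix $X$ is nonsingular. $O(\cdot)$ is understood as $\bm u,\bm u_{\mathrm{low}}\to0$ with $X$ (hence $n$) fixed. Interpretation: $\hat U,\hat\Sigma$ are the factors of an SVD of $X$ computed in lower precision, $\hat B$ is the computed product $X^*\hat U$, $\hat Q,\hat R$ are its computed QR factors in working precision, and $\hat Y$ is the computed product $X\hat Q$. *)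

theory Defs
  imports "HOL-Analysis.Analysis" "HOL-Library.Landau_Symbols"
begin

definition ctranspose :: "complex^'n^'m \<Rightarrow> complex^'m^'n" where
  "ctranspose A = (\<chi> i j. cnj (A $ j $ i))"

definition unitary :: "complex^'n^'n \<Rightarrow> bool" where
  "unitary A \<longleftrightarrow> ctranspose A ** A = mat 1 \<and> A ** ctranspose A = mat 1"

definition diagonal :: "complex^'n^'n \<Rightarrow> bool" where
  "diagonal A \<longleftrightarrow> (\<forall>i j. i \<noteq> j \<longrightarrow> A $ i $ j = 0)"

definition upper_triangular :: "complex^'n::{finite,linorder}^'n::{finite,linorder} \<Rightarrow> bool" where
  "upper_triangular A \<longleftrightarrow> (\<forall>i j. j < i \<longrightarrow> A $ i $ j = 0)"

(* Positive means in particular real; descending means non-increasing, so that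
   repeated entries are allowed. *)
definition diagonal_pos_descending :: "complex^'n::{finite,linorder}^'n::{finite,linorder} \<Rightarrow> bool" where
  "diagonal_pos_descending S \<longleftrightarrow> diagonal S \<and>
     (\<exists>s. (\<forall>i. S $ i $ i = complex_of_real (s i) \<and> 0 < s i) \<and> antimono s)"

definition off :: "complex^'n^'n \<Rightarrow> real" where
  "off M = sqrt (\<Sum>i\<in>UNIV. \<Sum>j\<in>UNIV - {i}. (cmod (M $ i $ j))\<^sup>2)"

(* The norm of a matrix as a vector of vectors is the Frobenius norm,
   see frobenius_norm_eq. *)
abbreviation frobenius_norm :: "complex^'n^'m \<Rightarrow> real" where
  "frobenius_norm A \<equiv> norm A"

lemma frobenius_norm_eq:
  fixes A :: "complex^'n^'m"
  shows "frobenius_norm A = sqrt (\<Sum>i\<in>UNIV. \<Sum>j\<in>UNIV. (cmod (A $ i $ j))\<^sup>2)"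
  by (simp add: norm_vec_def L2_set_def sum_nonneg)

abbreviation spectral_norm :: "complex^'n^'m \<Rightarrow> real" where
  "spectral_norm A \<equiv> onorm (\<lambda>x. A *v x)"

definition gamma_roundoff :: "nat \<Rightarrow> real \<Rightarrow> real" where
  "gamma_roundoff n u = real n * u / (1 - real n * u)"

end

theory Submission
  imports Defs
begin

text \<open>
  Write $G = U^*U - I$ and $N = S^{-1} U^* \<Delta>X V$. The off-diagonal part of $S^{-1} Y^* Y S^{-1}$ turns out
  to be bounded by \<open>norm G + 2 * norm N\<close> up to terms of order $u + u_{low}^2$, where no factor depending on
  the condition number of \<open>S\<close> multiplies \<open>G\<close>. The reason is that a QR factorization of $X^*U$ is a
  one-sided orthogonalization: $R^*R$ is known from $X^*U$, while $Y^*Y$ is close to $R\,(U^*U)^{-1} R^*$.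

  First, $Q_t$ is unitary and $Q_t R = X^*U + O(u)$, hence the upper triangular matrix $T = R S^{-1}$
  satisfies $T^*T = I + P$ with $P = (S^{-1}GS + N) + (S^{-1}GS + N)^*$ to second order. A triangular matrix
  that is nearly orthonormal is nearly diagonal, and the recursion of the Cholesky factorization shows that its
  entries above the diagonal are $T_{ij} = T_{ii} P_{ij}$ to second order (\<open>T_second_order\<close>).

  Second, $U^* X Q_t = R^* + O(u)$, hence $Y^*Y = R\,(U^*U)^{-1} R^* + O(u)$ and
  $S^{-1}Y^*YS^{-1} = L (I - G) L^*$ to second order, where $L = S^{-1}R = S^{-1} T S$. The entries
  $L_{ij} = (s_j/s_i)\,T_{ij}$ above the diagonal are damped, because \<open>S\<close> is descending. For $i < j$ the
  entry of the product is, up to a factor of modulus close to $1$,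
  $$(s_j/s_i)\,P_{ij} - G_{ij} = (s_j/s_i)^2\,G_{ij} + (s_j/s_i)\,(N_{ij} + \overline{N_{ji}}).$$
  The summand $(s_i/s_j)\,G_{ij}$ of $P_{ij}$, the only one that could be amplified, is cancelled exactly by
  $-G_{ij}$. All remaining coefficients are at most $1$, which gives \<open>off_M_bound\<close>.

  It remains to bound \<open>norm N\<close>. Norm inequalities give the version with the condition number
  (\<open>norm_weighted_residual_le\<close>). If the residual is small row by row, then
  $S^{-1}U^*D = (I + J)\,V^* Z^{-1}$ with $J = S^{-1}GS + N$, and the scaling $D$ of the rows is moved from \<open>X\<close>
  to the residual (\<open>norm_weighted_residual_le_rowwise\<close>). The coefficients $2$ and $2(1 + \|J\|) \le 4$ that
  arise are below $2(\sqrt 2 + \sqrt 3)$.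

  The remainders in the theorem may depend on the two precisions only, so the estimates have to be uniform over
  all admissible matrices. This is obtained by contradiction: if no constant worked, there would be a sequence of
  admissible data with $u_{low}$ tending to $0$ along which the asymptotic bound fails
  (\<open>uniform_off_bound\<close>). For that reason the perturbation theory is carried out for families indexed by an
  arbitrary filter. When $u_{low}$ is not small, the smallness hypothesis bounds the inverse of \<open>S\<close> in terms
  of $u$, because it contains the positive term $n \gamma_n \|X\|_2 \|S^{-1}\|_2$; then a crude bound
  (\<open>crude_off_bound\<close>) provides finite values for the remainders.
\<close>

section \<open>Frobenius and spectral norms of complex matrices\<close>

type_synonym 'n cmatrix = "((complex, 'n) vec, 'n) vec"

lemma matrix_mult_diff_ldistrib: "A ** (B - C) = A ** B - A ** (C :: 'a::ring_1^'n^'m)"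
  by (simp add: vec_eq_iff matrix_matrix_mult_def algebra_simps sum_subtractf)

lemma matrix_mult_diff_rdistrib: "(A - B) ** C = A ** C - (B :: 'a::ring_1^'n^'m) ** C"
  by (simp add: vec_eq_iff matrix_matrix_mult_def algebra_simps sum_subtractf)

lemma matrix_mult_add_rdistrib: "(A + B) ** C = A ** C + (B :: 'a::semiring_1^'n^'m) ** C"
  by (simp add: vec_eq_iff matrix_matrix_mult_def algebra_simps sum.distrib)

lemmas matrix_ring = matrix_add_ldistrib matrix_mult_add_rdistrib matrix_mult_diff_ldistrib
  matrix_mult_diff_rdistrib matrix_mul_assoc

lemma ctranspose_nth [simp]: "ctranspose A $ i $ j = cnj (A $ j $ i)"
  by (simp add: ctranspose_def)

lemma ctranspose_ctranspose [simp]: "ctranspose (ctranspose A) = A"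
  by (simp add: vec_eq_iff)

lemma ctranspose_add: "ctranspose (A + B) = ctranspose A + ctranspose B"
  by (simp add: vec_eq_iff)

lemma ctranspose_diff: "ctranspose (A - B) = ctranspose A - ctranspose B"
  by (simp add: vec_eq_iff)

lemma ctranspose_mult: "ctranspose (A ** B) = ctranspose B ** ctranspose A"
  by (simp add: vec_eq_iff matrix_matrix_mult_def mult.commute)

lemma ctranspose_mat_1 [simp]: "ctranspose (mat 1) = mat 1"
  by (simp add: vec_eq_iff mat_def)

lemmas ctranspose_simps = ctranspose_add ctranspose_diff ctranspose_mult

lemma power2_norm_vec: "(norm (x :: 'a::real_normed_vector^'n))\<^sup>2 = (\<Sum>i\<in>UNIV. (norm (x $ i))\<^sup>2)"
  by (simp add: norm_vec_def L2_set_def sum_nonneg)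

lemma power2_frobenius_norm:
  "(frobenius_norm A)\<^sup>2 = (\<Sum>i\<in>UNIV. \<Sum>j\<in>UNIV. (cmod (A $ i $ j))\<^sup>2)"
  by (simp add: power2_norm_vec)

lemma frobenius_norm_ctranspose [simp]: "frobenius_norm (ctranspose A) = frobenius_norm A"
proof -
  have "(frobenius_norm (ctranspose A))\<^sup>2 = (frobenius_norm A)\<^sup>2"
    unfolding power2_frobenius_norm by (simp, rule sum.swap)
  then show ?thesis by (simp add: power2_eq_iff_nonneg)
qed

lemma power2_frobenius_norm_columns: "(frobenius_norm A)\<^sup>2 = (\<Sum>j\<in>UNIV. (norm (column j A))\<^sup>2)"
  unfolding power2_frobenius_norm power2_norm_vec[of "column _ A"]
  by (simp add: column_def, rule sum.swap)

lemma spectral_norm_nonneg: "0 \<le> spectral_norm A"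
  by (simp add: onorm_pos_le)

lemma norm_matrix_vector_le: "norm (A *v x) \<le> spectral_norm A * norm x"
  for A :: "complex^'n^'m"
  by (simp add: onorm)

lemma column_matrix_mult: "column j (A ** B) = A *v column j B"
  by (simp add: vec_eq_iff column_def matrix_matrix_mult_def matrix_vector_mult_def)

lemma frobenius_norm_mult_le_spectral: "frobenius_norm (A ** B) \<le> spectral_norm A * frobenius_norm B"
proof -
  have "(norm (A ** B))\<^sup>2 = (\<Sum>j\<in>UNIV. (norm (A *v column j B))\<^sup>2)"
    by (simp add: power2_frobenius_norm_columns column_matrix_mult)
  also have "\<dots> \<le> (\<Sum>j\<in>UNIV. (spectral_norm A * norm (column j B))\<^sup>2)"
    by (intro sum_mono power_mono norm_matrix_vector_le) simp
  also have "\<dots> = (spectral_norm A * norm B)\<^sup>2"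
    by (simp add: power_mult_distrib power2_frobenius_norm_columns sum_distrib_left)
  finally show ?thesis
    by (simp add: abs_le_square_iff[symmetric] spectral_norm_nonneg)
qed

lemma spectral_norm_le_frobenius_norm: "spectral_norm A \<le> frobenius_norm A"
proof (rule onorm_le)
  fix x
  have row: "norm ((A *v x) $ i) \<le> norm (A $ i) * norm x" for i
  proof -
    have "norm ((A *v x) $ i) \<le> (\<Sum>j\<in>UNIV. norm (A $ i $ j) * norm (x $ j))"
      by (simp add: matrix_vector_mult_def norm_mult[symmetric] sum_norm_le)
    also have "\<dots> \<le> norm (A $ i) * norm x"
      unfolding norm_vec_def using L2_set_mult_ineq[of "\<lambda>j. norm (A $ i $ j)" "\<lambda>j. norm (x $ j)" UNIV] by simp
    finally show ?thesis .
  qed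
  have "(norm (A *v x))\<^sup>2 \<le> (\<Sum>i\<in>UNIV. (norm (A $ i) * norm x)\<^sup>2)"
    unfolding power2_norm_vec[of "A *v x"] by (intro sum_mono power_mono row) simp
  also have "\<dots> = (norm A * norm x)\<^sup>2"
    by (simp add: power_mult_distrib power2_norm_vec[of A] sum_distrib_right)
  finally show "norm (A *v x) \<le> norm A * norm x"
    by (simp add: abs_le_square_iff[symmetric])
qed

lemma frobenius_norm_mult_le: "frobenius_norm (A ** B) \<le> frobenius_norm A * frobenius_norm B"
  by (meson frobenius_norm_mult_le_spectral spectral_norm_le_frobenius_norm mult_right_mono norm_ge_zero order_trans)

lemma frobenius_norm_mat_1: "frobenius_norm (mat 1 :: complex^'n^'n) = sqrt (real CARD('n))"
proof -
  have "(\<Sum>j\<in>UNIV. (cmod ((mat 1 :: complex^'n^'n) $ i $ j))\<^sup>2) = 1" for i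
  proof -
    have "(\<Sum>j\<in>UNIV. (cmod ((mat 1 :: complex^'n^'n) $ i $ j))\<^sup>2) = (\<Sum>j\<in>UNIV. if j = i then 1 else 0)"
      by (rule sum.cong) (auto simp: mat_def)
    then show ?thesis by simp
  qed
  then show ?thesis by (simp add: frobenius_norm_eq)
qed

lemma frobenius_norm_le_spectral:
  "frobenius_norm A \<le> sqrt (real CARD('n)) * spectral_norm A" for A :: "complex^'n^'m"
  using frobenius_norm_mult_le_spectral[of A "mat 1"] by (simp add: frobenius_norm_mat_1 mult.commute)

lemma inner_matrix_vector_ctranspose: "inner (A *v x) y = inner x (ctranspose A *v y)"
  for A :: "complex^'n^'m"
proof -
  have inner: "inner v w = Re (\<Sum>i\<in>UNIV. v $ i * cnj (w $ i))" for v w :: "complex^'a"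
    by (simp add: inner_vec_def inner_complex_def)
  have "(\<Sum>i\<in>UNIV. (A *v x) $ i * cnj (y $ i)) = (\<Sum>i\<in>UNIV. \<Sum>j\<in>UNIV. A $ i $ j * x $ j * cnj (y $ i))"
    by (simp add: matrix_vector_mult_def sum_distrib_right)
  also have "\<dots> = (\<Sum>j\<in>UNIV. \<Sum>i\<in>UNIV. A $ i $ j * x $ j * cnj (y $ i))"
    by (rule sum.swap)
  also have "\<dots> = (\<Sum>j\<in>UNIV. x $ j * cnj ((ctranspose A *v y) $ j))"
    by (simp add: matrix_vector_mult_def sum_distrib_left mult_ac)
  finally show ?thesis by (simp only: inner)
qed

text \<open>
  From \<open>norm (A^* y)^2 = inner (A (A^* y)) y\<close> one factor \<open>norm (A^* y)\<close> cancels; this avoids singular values.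
\<close>

lemma spectral_norm_ctranspose_le: "spectral_norm (ctranspose A) \<le> spectral_norm A"
proof (rule onorm_le)
  fix y
  let ?z = "ctranspose A *v y"
  have "(norm ?z)\<^sup>2 = inner (A *v ?z) y"
    by (simp add: inner_matrix_vector_ctranspose power2_norm_eq_inner)
  also have "\<dots> \<le> norm (A *v ?z) * norm y"
    by (rule norm_cauchy_schwarz)
  also have "\<dots> \<le> spectral_norm A * norm ?z * norm y"
    by (intro mult_right_mono norm_matrix_vector_le) simp
  finally have "norm ?z * norm ?z \<le> norm ?z * (spectral_norm A * norm y)"
    by (simp add: power2_eq_square mult_ac)
  then show "norm ?z \<le> spectral_norm A * norm y"
    by (cases "norm ?z = 0") (simp_all add: spectral_norm_nonneg)
qed

lemma unitary_ctranspose: "unitary A \<Longrightarrow> unitary (ctranspose A)"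
  by (simp add: unitary_def)

lemma frobenius_norm_unitary_mult:
  assumes "unitary Q" shows "frobenius_norm (Q ** A) = frobenius_norm A"
proof -
  have "norm (Q *v x) = norm x" if "unitary Q" for x and Q :: "complex^'a^'a"
  proof -
    have "(norm (Q *v x))\<^sup>2 = (norm x)\<^sup>2"
      using that by (simp add: power2_norm_eq_inner inner_matrix_vector_ctranspose
         matrix_vector_mul_assoc unitary_def)
    then show ?thesis by (simp add: power2_eq_iff_nonneg)
  qed
  from this[OF assms] have "(norm (Q ** A))\<^sup>2 = (norm A)\<^sup>2"
    by (simp add: power2_frobenius_norm_columns column_matrix_mult)
  then show ?thesis by (simp add: power2_eq_iff_nonneg)
qed

lemma frobenius_norm_mult_unitary:
  assumes "unitary Q" shows "frobenius_norm (A ** Q) = frobenius_norm A"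
  by (metis assms ctranspose_mult frobenius_norm_ctranspose frobenius_norm_unitary_mult unitary_ctranspose)

text \<open>
  Expand \<open>norm (U x)^2 = inner x (U^* U x)\<close>. This gives \<open>sqrt (1 + c)\<close>; the larger \<open>1 + c\<close> is the
  form in which the error of the computed singular vectors enters the final estimate.
\<close>

lemma spectral_norm_le_of_gram:
  assumes "frobenius_norm (ctranspose U ** U - mat 1) \<le> c"
  shows "spectral_norm U \<le> 1 + c"
proof (rule onorm_le)
  fix x
  let ?G = "ctranspose U ** U - mat 1"
  have c: "0 \<le> c" using assms norm_ge_zero order_trans by blast
  have "(norm (U *v x))\<^sup>2 = inner x (ctranspose U *v (U *v x))"
    by (simp add: power2_norm_eq_inner inner_matrix_vector_ctranspose)
  also have "\<dots> = inner x x + inner x (?G *v x)"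
    by (simp add: matrix_vector_mul_assoc matrix_vector_mult_diff_rdistrib inner_diff_right)
  also have "inner x (?G *v x) \<le> norm x * norm (?G *v x)"
    by (rule norm_cauchy_schwarz)
  also have "norm (?G *v x) \<le> c * norm x"
    by (meson assms norm_matrix_vector_le spectral_norm_le_frobenius_norm mult_right_mono norm_ge_zero order_trans)
  finally have "(norm (U *v x))\<^sup>2 \<le> inner x x + norm x * (c * norm x)"
    by (simp add: mult_left_mono)
  also have "\<dots> = (1 + c) * (norm x)\<^sup>2"
    by (simp add: power2_norm_eq_inner[symmetric] power2_eq_square algebra_simps)
  also have "\<dots> \<le> ((1 + c) * norm x)\<^sup>2"
    using c by (simp add: power_mult_distrib power2_eq_square mult_right_mono algebra_simps)
  finally show "norm (U *v x) \<le> (1 + c) * norm x"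
    using c by (simp add: abs_le_square_iff[symmetric])
qed

text \<open>
  A vector in the kernel of \<open>A\<close> would be reproduced by the strict contraction \<open>mat 1 - A\<close>.
\<close>

lemma invertible_of_norm_diff_mat_1:
  fixes A :: "complex^'n^'n"
  assumes "frobenius_norm (A - mat 1) < 1"
  shows "invertible A"
proof -
  have "x = 0" if "A *v x = 0" for x
  proof (rule ccontr)
    assume "x \<noteq> 0"
    have "norm x = norm ((A - mat 1) *v x)"
      using that by (simp add: matrix_vector_mult_diff_rdistrib)
    also have "\<dots> \<le> norm (A - mat 1) * norm x"
      by (meson norm_matrix_vector_le spectral_norm_le_frobenius_norm mult_right_mono norm_ge_zero order_trans)
    also have "\<dots> < norm x" using assms \<open>x \<noteq> 0\<close> by simp
    finally show False by simp
  qed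
  then have "\<exists>B. B ** A = mat 1" unfolding matrix_left_invertible_ker by blast
  then show ?thesis by (simp add: invertible_left_inverse)
qed

definition diag_matrix :: "('n \<Rightarrow> complex) \<Rightarrow> complex^'n^'n" where
  "diag_matrix d = (\<chi> i j. if i = j then d i else 0)"

lemma diag_matrix_nth: "diag_matrix d $ i $ j = (if i = j then d i else 0)"
  by (simp add: diag_matrix_def)

lemma diag_matrix_mult_nth: "(diag_matrix d ** A) $ i $ j = d i * A $ i $ j"
proof -
  have "(diag_matrix d ** A) $ i $ j = (\<Sum>k\<in>UNIV. if k = i then d i * A $ i $ j else 0)"
    unfolding matrix_matrix_mult_def vec_lambda_beta by (rule sum.cong) (auto simp: diag_matrix_nth)
  then show ?thesis by simp
qed

lemma mult_diag_matrix_nth: "(A ** diag_matrix d) $ i $ j = A $ i $ j * d j"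
proof -
  have "(A ** diag_matrix d) $ i $ j = (\<Sum>k\<in>UNIV. if k = j then A $ i $ j * d j else 0)"
    unfolding matrix_matrix_mult_def vec_lambda_beta by (rule sum.cong) (auto simp: diag_matrix_nth)
  then show ?thesis by simp
qed

lemma ctranspose_diag_matrix: "ctranspose (diag_matrix d) = diag_matrix (\<lambda>i. cnj (d i))"
  by (simp add: vec_eq_iff diag_matrix_nth)

lemma diagonal_pos_descending_cases:
  assumes "diagonal_pos_descending S"
  obtains s where "\<And>i. 0 < s i" "antimono s" "S = diag_matrix (\<lambda>i. complex_of_real (s i))"
    "matrix_inv S = diag_matrix (\<lambda>i. complex_of_real (1 / s i))"
    "S ** matrix_inv S = mat 1" "matrix_inv S ** S = mat 1"
proof -
  obtain s where s: "\<And>i. 0 < s i" "antimono s" and S: "S = diag_matrix (\<lambda>i. complex_of_real (s i))"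
  proof -
    obtain s where "diagonal S" and s: "\<And>i. S $ i $ i = complex_of_real (s i)" "\<And>i. 0 < s i" "antimono s"
      using assms unfolding diagonal_pos_descending_def by blast
    then have "S = diag_matrix (\<lambda>i. complex_of_real (s i))"
      by (simp add: vec_eq_iff diagonal_def diag_matrix_nth)
    with s that show thesis by blast
  qed
  define D where "D = diag_matrix (\<lambda>i. complex_of_real (1 / s i))"
  have s0: "s i \<noteq> 0" for i using s(1)[of i] by simp
  have SD: "S ** D = mat 1"
    by (simp add: S D_def vec_eq_iff diag_matrix_mult_nth diag_matrix_nth mat_def s0)
  have DS: "D ** S = mat 1"
    by (simp add: S D_def vec_eq_iff diag_matrix_mult_nth diag_matrix_nth mat_def s0)
  have inv: "S ** matrix_inv S = mat 1 \<and> matrix_inv S ** S = mat 1"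
    unfolding matrix_inv_def by (rule someI[of _ D]) (simp add: SD DS)
  have "matrix_inv S = D ** S ** matrix_inv S" by (simp add: DS)
  also have "\<dots> = D" using inv by (simp flip: matrix_mul_assoc)
  finally show ?thesis using that[OF s S] D_def SD DS by simp
qed

lemma spectral_norm_pos: "invertible X \<Longrightarrow> 0 < spectral_norm (X :: complex^'n^'n)"
proof -
  assume "invertible X"
  then obtain Xi where "X ** Xi = mat 1" unfolding invertible_def by blast
  then have "norm (mat 1 :: complex^'n^'n) \<le> spectral_norm X * norm Xi"
    by (metis frobenius_norm_mult_le_spectral)
  then show "0 < spectral_norm X"
    using spectral_norm_nonneg[of X] by (auto simp: frobenius_norm_mat_1 not_le less_le)
qed

lemma off_eq_norm: "off A = norm (\<chi> i j. if i = j then 0 else A $ i $ j)"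
proof -
  have "(\<Sum>j\<in>UNIV - {i}. (cmod (A $ i $ j))\<^sup>2) = (\<Sum>j\<in>UNIV. (cmod (if i = j then 0 else A $ i $ j))\<^sup>2)" for i
    by (rule sum.mono_neutral_cong_left) auto
  then show ?thesis by (simp add: off_def frobenius_norm_eq)
qed

lemma norm_matrix_mono:
  fixes A :: "'a::real_normed_vector^'n^'m" and B :: "'b::real_normed_vector^'n^'m"
  assumes "\<And>i j. norm (A $ i $ j) \<le> norm (B $ i $ j)"
  shows "norm A \<le> norm B"
  unfolding norm_vec_def by (intro L2_set_mono assms) simp_all

lemma off_le_frobenius_norm: "off A \<le> frobenius_norm A"
  unfolding off_eq_norm by (rule norm_matrix_mono) simp

text \<open>
  This turns entrywise estimates away from the diagonal into a norm estimate. The two entries of \<open>C\<close> come from a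
  matrix plus its conjugate transpose, so each contributes the norm of \<open>C\<close> once.
\<close>

lemma off_le_of_entries:
  fixes A B C :: "complex^'n^'n" and D :: "real^'n^'n"
  assumes "\<And>i j. i \<noteq> j \<Longrightarrow> cmod (A $ i $ j) \<le> cmod (B $ i $ j) + cmod (C $ i $ j) + cmod (C $ j $ i) + D $ i $ j"
  shows "off A \<le> norm B + 2 * norm C + norm D"
proof -
  define abs_matrix where "abs_matrix E = (\<chi> i j. cmod (E $ i $ j))" for E :: "complex^'n^'n"
  have norm_abs: "norm (abs_matrix E) = norm E" for E
    by (intro antisym norm_matrix_mono) (simp_all add: abs_matrix_def)
  have "off A \<le> norm (abs_matrix B + abs_matrix C + abs_matrix (ctranspose C) + D)"
    unfolding off_eq_norm
  proof (rule norm_matrix_mono)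
    show "norm ((\<chi> i j. if i = j then 0 else A $ i $ j) $ i $ j)
        \<le> norm ((abs_matrix B + abs_matrix C + abs_matrix (ctranspose C) + D) $ i $ j)" for i j
      using assms[of i j] by (cases "i = j") (simp_all add: abs_matrix_def)
  qed
  also have "\<dots> \<le> norm (abs_matrix B) + norm (abs_matrix C) + norm (abs_matrix (ctranspose C)) + norm D"
    by (meson norm_triangle_ineq add_right_mono order_trans)
  finally show ?thesis by (simp add: norm_abs)
qed

text \<open>
  In the application \<open>W\<close> is the inverse of \<open>S\<close>. The identity says that $W U^*$ is, up to the
  perturbation in parentheses, a left inverse of \<open>X\<close> followed by the unitary factor. It is what relates
  both the triangular factor and the row scaling of \<open>X\<close> to the two sources of error.
\<close>

lemma weighted_factor_identity:
  assumes "X = U ** S ** ctranspose V + \<Delta>X" "unitary V" "W ** S = mat 1"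
  shows "W ** ctranspose U ** X
    = (mat 1 + (W ** (ctranspose U ** U - mat 1) ** S + W ** ctranspose U ** \<Delta>X ** V)) ** ctranspose V"
proof -
  have V_cancel: "A ** V ** ctranspose V = A" for A :: "complex^'a^'a"
    using assms(2) by (simp add: unitary_def flip: matrix_mul_assoc)
  have "W ** ctranspose U ** X = W ** (ctranspose U ** U) ** S ** ctranspose V + W ** ctranspose U ** \<Delta>X"
    by (simp add: assms(1) matrix_ring)
  also have "W ** (ctranspose U ** U) ** S = mat 1 + W ** (ctranspose U ** U - mat 1) ** S"
    by (simp add: matrix_ring assms(3))
  finally show ?thesis by (simp only: matrix_mult_add_rdistrib V_cancel add.assoc)
qed

section \<open>Landau bounds for norms of vectors and matrices\<close>

text \<open>
  Landau symbols compare functions with values in one normed field. Passing to norms extends them to vector- and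
  matrix-valued functions, while the comparison function stays real.
\<close>

definition norm_bigo :: "'a filter \<Rightarrow> ('a \<Rightarrow> real) \<Rightarrow> ('a \<Rightarrow> 'b::real_normed_vector) \<Rightarrow> bool" where
  "norm_bigo F h f \<longleftrightarrow> (\<lambda>t. norm (f t)) \<in> O[F](h)"

lemma norm_bigo_norm: "norm_bigo F h (\<lambda>t. norm (f t)) \<longleftrightarrow> norm_bigo F h f"
  by (simp only: norm_bigo_def real_norm_def abs_norm_cancel)

lemma norm_bigo_real: "norm_bigo F h f \<longleftrightarrow> f \<in> O[F](h)" for f :: "'a \<Rightarrow> real"
  unfolding norm_bigo_def real_norm_def by (rule landau_o.big.abs_in_iff)

lemma norm_bigo_bound:
  assumes "norm_bigo F h f" "\<And>t. norm (f' t) \<le> norm (f t)"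
  shows "norm_bigo F h f'"
proof -
  have "(\<lambda>t. norm (f' t)) \<in> O[F](\<lambda>t. norm (f t))"
    by (rule landau_o.big_mono) (simp add: assms(2))
  with assms(1) show ?thesis unfolding norm_bigo_def by (rule landau_o.big_trans[rotated])
qed

lemma norm_bigo_trans: "norm_bigo F h f \<Longrightarrow> h \<in> O[F](k) \<Longrightarrow> norm_bigo F k f"
  unfolding norm_bigo_def by (rule landau_o.big_trans)

lemma norm_bigo_add:
  assumes "norm_bigo F h f" "norm_bigo F h f'"
  shows "norm_bigo F h (\<lambda>t. f t + f' t)"
proof -
  have "(\<lambda>t. norm (f t) + norm (f' t)) \<in> O[F](h)"
    using assms unfolding norm_bigo_def by (rule sum_in_bigo)
  then have "norm_bigo F h (\<lambda>t. norm (f t) + norm (f' t))"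
    unfolding norm_bigo_real .
  moreover have "norm (f t + f' t) \<le> norm (norm (f t) + norm (f' t))" for t
    unfolding real_norm_def by (rule order_trans[OF norm_triangle_ineq abs_ge_self])
  ultimately show ?thesis by (rule norm_bigo_bound)
qed

lemma norm_bigo_minus: "norm_bigo F h f \<Longrightarrow> norm_bigo F h (\<lambda>t. - f t)"
  by (simp add: norm_bigo_def)

lemma norm_bigo_diff: "norm_bigo F h f \<Longrightarrow> norm_bigo F h f' \<Longrightarrow> norm_bigo F h (\<lambda>t. f t - f' t)"
  using norm_bigo_add[of F h f "\<lambda>t. - f' t"] by (simp add: norm_bigo_minus)

lemma norm_bigo_zero: "norm_bigo F h (\<lambda>_. 0)"
  unfolding norm_bigo_def norm_zero by (rule zero_in_bigo)

lemma norm_bigo_sum: "(\<And>i. i \<in> I \<Longrightarrow> norm_bigo F h (f i)) \<Longrightarrow> norm_bigo F h (\<lambda>t. \<Sum>i\<in>I. f i t)"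
  by (induct I rule: infinite_finite_induct) (simp_all add: norm_bigo_zero norm_bigo_add)

lemma norm_bigo_const: "norm_bigo F (\<lambda>_. 1) (\<lambda>_. c)"
  unfolding norm_bigo_def by (rule bigo_const)

lemma norm_bigo_mult:
  fixes f f' :: "'a \<Rightarrow> 'b::real_normed_div_algebra"
  assumes "norm_bigo F h f" "norm_bigo F k f'"
  shows "norm_bigo F (\<lambda>t. h t * k t) (\<lambda>t. f t * f' t)"
  using assms unfolding norm_bigo_def norm_mult by (rule landau_o.big.mult)

lemma norm_bigo_matrix_mult:
  assumes "norm_bigo F h A" "norm_bigo F k B"
  shows "norm_bigo F (\<lambda>t. h t * k t) (\<lambda>t. A t ** B t :: complex^'n^'m)"
proof (rule norm_bigo_bound)
  show "norm_bigo F (\<lambda>t. h t * k t) (\<lambda>t. norm (A t) * norm (B t))"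
    using assms by (intro norm_bigo_mult) (simp_all only: norm_bigo_norm)
  show "norm (A t ** B t) \<le> norm (norm (A t) * norm (B t))" for t
    using frobenius_norm_mult_le[of "A t" "B t"] unfolding real_norm_def by linarith
qed

lemma norm_bigo_ctranspose: "norm_bigo F h A \<Longrightarrow> norm_bigo F h (\<lambda>t. ctranspose (A t))"
  by (simp add: norm_bigo_def)

lemma norm_bigo_nth: "norm_bigo F h x \<Longrightarrow> norm_bigo F h (\<lambda>t. x t $ i)"
  by (erule norm_bigo_bound) (rule Finite_Cartesian_Product.norm_nth_le)

lemma norm_bigo_vecI:
  assumes "\<And>i. norm_bigo F h (\<lambda>t. x t $ i)"
  shows "norm_bigo F h (x :: 'a \<Rightarrow> 'b::real_normed_vector^'n)"
proof (rule norm_bigo_bound)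
  show "norm_bigo F h (\<lambda>t. \<Sum>i\<in>UNIV. norm (x t $ i))"
    by (rule norm_bigo_sum) (use assms in \<open>simp only: norm_bigo_norm\<close>)
  show "norm (x t) \<le> norm (\<Sum>i\<in>UNIV. norm (x t $ i))" for t
  proof -
    have "norm (x t) \<le> (\<Sum>i\<in>UNIV. norm (x t $ i))"
      unfolding norm_vec_def by (rule L2_set_le_sum) simp
    then show ?thesis unfolding real_norm_def by (rule order_trans[OF _ abs_ge_self])
  qed
qed

text \<open>
  A bound that contains the unknown itself with a coefficient tending to zero can be solved for the unknown. This
  is how inverses, and entries defined implicitly, are estimated without explicit constants.
\<close>

lemma norm_bigo_absorb:
  assumes B: "norm_bigo F h B" and c: "(c \<longlongrightarrow> 0) F"
    and le: "\<And>t. norm (A t) \<le> norm (B t) + c t * norm (A t)"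
  shows "norm_bigo F h A"
proof -
  have "eventually (\<lambda>t. c t < 1/2) F"
    by (rule order_tendstoD(2)[OF c]) simp
  then have "eventually (\<lambda>t. norm (norm (A t)) \<le> 2 * norm (norm (B t))) F"
  proof eventually_elim
    case (elim t)
    have "norm (A t) \<le> norm (B t) + c t * norm (A t)" by (rule le)
    also have "c t * norm (A t) \<le> 1/2 * norm (A t)"
      using elim by (intro mult_right_mono) auto
    finally show ?case by simp
  qed
  then have "(\<lambda>t. norm (A t)) \<in> O[F](\<lambda>t. norm (B t))" by (rule bigoI)
  with B show ?thesis unfolding norm_bigo_def by (rule landau_o.big_trans[rotated])
qed

lemma norm_bigo_tendsto_0:
  assumes "norm_bigo F h f" "(h \<longlongrightarrow> 0) F"
  shows "((\<lambda>t. norm (f t)) \<longlongrightarrow> 0) F"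
proof -
  obtain c where "eventually (\<lambda>t. norm (norm (f t)) \<le> c * norm (h t)) F"
    using assms(1) unfolding norm_bigo_def by (elim landau_o.bigE)
  moreover have "((\<lambda>t. c * norm (h t)) \<longlongrightarrow> 0) F"
    using tendsto_mult_right_zero[OF tendsto_norm_zero[OF assms(2)]] .
  ultimately show ?thesis
    by (rule Lim_null_comparison)
qed

lemma norm_bigo_le:
  assumes "norm_bigo F h f" "\<And>t. norm (f' t) \<le> f t"
  shows "norm_bigo F h f'"
  using norm_bigo_bound[OF assms(1), of f'] order_trans[OF assms(2) abs_ge_self]
  unfolding real_norm_def by blast

section \<open>Families of perturbed singular value decompositions\<close>

text \<open>
  A family of perturbed decompositions of one fixed matrix \<open>X\<close>. The function \<open>e\<close> is the first-order scale (the
  lower precision) and \<open>g\<close> the scale of all terms that are to be neglected. Besides \<open>e\<close> tending to \<open>0\<close>,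
  they are related by \<open>e^2 = O(g)\<close> and \<open>g = O(e)\<close>, so that a bound is always of one of the three sizes \<open>1\<close>, \<open>e\<close> and \<open>g\<close>. All rounding
  errors of the working precision are collected in the backward errors \<open>E\<close> and \<open>E'\<close>.
\<close>

locale perturbed_svd =
  fixes F :: "'a filter" and e g :: "'a \<Rightarrow> real"
    and X :: "'n::{finite,linorder} cmatrix"
    and U S V \<Delta>X R E Qt Y E' :: "'a \<Rightarrow> 'n::{finite,linorder} cmatrix"
  assumes e_tendsto: "(e \<longlongrightarrow> 0) F"
    and e_squared: "(\<lambda>t. e t * e t) \<in> O[F](g)"
    and g_bigo_e: "g \<in> O[F](e)"
    and invertible: "invertible X"
    and unitary_V: "\<And>t. unitary (V t)"
    and unitary_Qt: "\<And>t. unitary (Qt t)"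
    and upper_R: "\<And>t. upper_triangular (R t)"
    and S: "\<And>t. diagonal_pos_descending (S t)"
    and svd: "\<And>t. X = U t ** S t ** ctranspose (V t) + \<Delta>X t"
    and qr: "\<And>t. Qt t ** R t = ctranspose X ** U t + E t"
    and Y: "\<And>t. Y t = X ** Qt t + E' t"
    and gram_less_1: "\<And>t. frobenius_norm (ctranspose (U t) ** U t - mat 1) < 1"
    and gram_bigo: "norm_bigo F e (\<lambda>t. ctranspose (U t) ** U t - mat 1)"
    and \<Delta>X_bigo: "norm_bigo F e \<Delta>X"
    and E_bigo: "norm_bigo F g E"
    and E'_bigo: "norm_bigo F g E'"
begin

text \<open>
  \<open>G\<close> and \<open>N\<close> are the two first-order perturbations: lost orthogonality of \<open>U\<close>, and the residual of the
  decomposition as seen from the scaled basis. \<open>J\<close> collects both, with \<open>G\<close> distorted by the scaling. \<open>T\<close> and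
  \<open>L\<close> are the triangular factor scaled from the right and from the left; \<open>P\<close> measures how far \<open>T\<close> is from
  orthonormal columns. \<open>M\<close> is the matrix whose off-diagonal part is to be estimated.
\<close>

definition "G t = ctranspose (U t) ** U t - mat 1"
definition "Si t = matrix_inv (S t)"
definition "N t = Si t ** ctranspose (U t) ** \<Delta>X t ** V t"
definition "J t = Si t ** G t ** S t + N t"
definition "T t = R t ** Si t"
definition "P t = ctranspose (T t) ** T t - mat 1"
definition "L t = Si t ** R t"
definition "H t = matrix_inv (ctranspose (U t) ** U t)"
definition "M t = Si t ** ctranspose (Y t) ** Y t ** Si t"
definition "s t i = Re (S t $ i $ i)"

lemma e_bigo_1: "e \<in> O[F](\<lambda>_. 1)"
  using e_tendsto by (intro bigoI_tendsto[where c = 0]) auto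

abbreviation "O1 \<equiv> norm_bigo F (\<lambda>_. 1)"
abbreviation "Oe \<equiv> norm_bigo F e"
abbreviation "Og \<equiv> norm_bigo F g"

lemma bigo_weaken: "Og f \<Longrightarrow> Oe f" "Oe f \<Longrightarrow> O1 f"
  using norm_bigo_trans g_bigo_e e_bigo_1 by blast+

text \<open>
  The rules for the three sizes: a bounded factor preserves the size, and the product of two first-order factors
  is negligible.
\<close>

lemma matrix_mult_bigo:
  fixes A B :: "'a \<Rightarrow> 'n::{finite,linorder} cmatrix"
  shows "O1 A \<Longrightarrow> norm_bigo F h B \<Longrightarrow> norm_bigo F h (\<lambda>t. A t ** B t)"
    and "norm_bigo F h A \<Longrightarrow> O1 B \<Longrightarrow> norm_bigo F h (\<lambda>t. A t ** B t)"
    and "Oe A \<Longrightarrow> Oe B \<Longrightarrow> Og (\<lambda>t. A t ** B t)"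
  using norm_bigo_matrix_mult[of F "\<lambda>_. 1" A h B] norm_bigo_matrix_mult[of F h A "\<lambda>_. 1" B]
    norm_bigo_trans[OF norm_bigo_matrix_mult[of F e A e B] e_squared] by simp_all

lemma mult_bigo:
  fixes x y :: "'a \<Rightarrow> 'b::real_normed_div_algebra"
  shows "O1 x \<Longrightarrow> norm_bigo F h y \<Longrightarrow> norm_bigo F h (\<lambda>t. x t * y t)"
    and "norm_bigo F h x \<Longrightarrow> O1 y \<Longrightarrow> norm_bigo F h (\<lambda>t. x t * y t)"
    and "Oe x \<Longrightarrow> Oe y \<Longrightarrow> Og (\<lambda>t. x t * y t)"
  using norm_bigo_mult[of F "\<lambda>_. 1" x h y] norm_bigo_mult[of F h x "\<lambda>_. 1" y]
    norm_bigo_trans[OF norm_bigo_mult[of F e x e y] e_squared] by simp_all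

lemma s_pos: "0 < s t i" and s_antimono: "i \<le> j \<Longrightarrow> s t j \<le> s t i"
  and S_eq: "S t = diag_matrix (\<lambda>i. complex_of_real (s t i))"
  and Si_eq: "Si t = diag_matrix (\<lambda>i. complex_of_real (1 / s t i))"
  and S_Si: "S t ** Si t = mat 1" and Si_S: "Si t ** S t = mat 1"
proof -
  obtain \<sigma> where \<sigma>: "\<And>i. 0 < \<sigma> i" "antimono \<sigma>" "S t = diag_matrix (\<lambda>i. complex_of_real (\<sigma> i))"
    "matrix_inv (S t) = diag_matrix (\<lambda>i. complex_of_real (1 / \<sigma> i))"
    "S t ** matrix_inv (S t) = mat 1" "matrix_inv (S t) ** S t = mat 1"
    by (rule diagonal_pos_descending_cases[OF S[of t]]) blast
  have "s t = \<sigma>" by (rule ext) (simp add: s_def \<sigma>(3) diag_matrix_nth)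
  with \<sigma> show "0 < s t i" "i \<le> j \<Longrightarrow> s t j \<le> s t i"
    "S t = diag_matrix (\<lambda>i. complex_of_real (s t i))"
    "Si t = diag_matrix (\<lambda>i. complex_of_real (1 / s t i))"
    "S t ** Si t = mat 1" "Si t ** S t = mat 1"
    by (auto simp: Si_def antimono_def)
qed

lemma unitary_simps:
  "ctranspose (V t) ** V t = mat 1" "V t ** ctranspose (V t) = mat 1"
  "ctranspose (Qt t) ** Qt t = mat 1" "Qt t ** ctranspose (Qt t) = mat 1"
  using unitary_V[of t] unitary_Qt[of t] by (simp_all add: unitary_def)

lemma ctranspose_Si: "ctranspose (Si t) = Si t"
  by (auto simp: Si_eq vec_eq_iff diag_matrix_nth)

lemma ctranspose_G: "ctranspose (G t) = G t"
  by (simp add: G_def ctranspose_simps)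

lemma gram_U: "ctranspose (U t) ** U t = mat 1 + G t"
  by (simp add: G_def)

lemma left_cancel: "A ** B = mat 1 \<Longrightarrow> C ** A ** B = (C :: 'n::{finite,linorder} cmatrix)"
  by (simp flip: matrix_mul_assoc)

lemma G_bigo: "Oe G" using gram_bigo by (simp add: G_def[abs_def])

lemma unitary_bigo: "(\<And>t. unitary (Q t)) \<Longrightarrow> O1 (Q :: 'a \<Rightarrow> 'n::{finite,linorder} cmatrix)"
proof (rule norm_bigo_bound[OF norm_bigo_const])
  assume "\<And>t. unitary (Q t)"
  then show "norm (Q t) \<le> norm (mat 1 :: 'n::{finite,linorder} cmatrix)" for t
    using frobenius_norm_unitary_mult[of "Q t" "mat 1"] by simp
qed

lemma U_bigo: "O1 U"
proof (rule norm_bigo_bound)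
  show "O1 (\<lambda>_. sqrt (real CARD('n)) * 2)" by (rule norm_bigo_const)
  show "norm (U t) \<le> norm (sqrt (real CARD('n)) * 2)" for t
  proof -
    have "spectral_norm (U t) \<le> 2"
      using spectral_norm_le_of_gram[of "U t" 1] gram_less_1[of t] by simp
    then have "sqrt (real CARD('n)) * spectral_norm (U t) \<le> sqrt (real CARD('n)) * 2"
      by (intro mult_left_mono) simp_all
    with frobenius_norm_le_spectral[of "U t"] have "norm (U t) \<le> sqrt (real CARD('n)) * 2"
      by (rule order_trans)
    then show ?thesis by simp
  qed
qed

lemma X_mult_V: "X ** V t = U t ** S t + \<Delta>X t ** V t"
  using arg_cong[OF svd[of t], of "\<lambda>A. A ** V t"]
  by (simp add: matrix_ring left_cancel[OF unitary_simps(1)])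

text \<open>
  Since \<open>U\<close> and \<open>X\<close> are bounded, \<open>S = U^* (X - \<Delta>X) V - G S\<close> determines \<open>S\<close> up to an absorbable term.
\<close>

lemma S_bigo: "O1 S"
proof (rule norm_bigo_absorb)
  show "O1 (\<lambda>t. ctranspose (U t) ** (X ** V t - \<Delta>X t ** V t))"
    by (intro matrix_mult_bigo(1) norm_bigo_ctranspose norm_bigo_diff U_bigo norm_bigo_const
        unitary_bigo unitary_V bigo_weaken(2)[OF \<Delta>X_bigo] matrix_mult_bigo(2))
  show "((\<lambda>t. norm (G t)) \<longlongrightarrow> 0) F" by (rule norm_bigo_tendsto_0[OF G_bigo e_tendsto])
  show "norm (S t) \<le> norm (ctranspose (U t) ** (X ** V t - \<Delta>X t ** V t)) + norm (G t) * norm (S t)" for t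
  proof -
    have "S t = ctranspose (U t) ** (X ** V t - \<Delta>X t ** V t) - G t ** S t"
      by (simp add: X_mult_V matrix_ring gram_U)
    then have "norm (S t) \<le> norm (ctranspose (U t) ** (X ** V t - \<Delta>X t ** V t)) + norm (G t ** S t)"
      by (metis norm_triangle_ineq4)
    then show ?thesis using frobenius_norm_mult_le[of "G t" "S t"] by simp
  qed
qed

text \<open>
  Multiplying $XV = US + \<Delta>X V$ by the inverses of \<open>X\<close> and \<open>S\<close> expresses $V S^{-1}$ by bounded terms and
  an absorbable one. Here nonsingularity of the fixed matrix \<open>X\<close> enters.
\<close>

lemma Si_bigo: "O1 Si"
proof -
  obtain Xi where Xi: "Xi ** X = mat 1" using invertible invertible_left_inverse by blast
  show ?thesis
  proof (rule norm_bigo_absorb)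
    show "O1 (\<lambda>t. Xi ** U t)"
      by (intro matrix_mult_bigo(1) norm_bigo_const U_bigo)
    have "Oe (\<lambda>t. Xi ** \<Delta>X t)"
      by (intro matrix_mult_bigo(1) norm_bigo_const \<Delta>X_bigo)
    then show "((\<lambda>t. norm (Xi ** \<Delta>X t)) \<longlongrightarrow> 0) F"
      by (rule norm_bigo_tendsto_0[OF _ e_tendsto])
    show "norm (Si t) \<le> norm (Xi ** U t) + norm (Xi ** \<Delta>X t) * norm (Si t)" for t
    proof -
      have "Xi ** U t + Xi ** \<Delta>X t ** (V t ** Si t) = Xi ** (U t ** S t + \<Delta>X t ** V t) ** Si t"
        by (simp add: matrix_ring left_cancel[OF S_Si])
      also have "\<dots> = V t ** Si t"
        by (simp add: X_mult_V[symmetric] matrix_ring Xi)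
      finally have "norm (V t ** Si t) \<le> norm (Xi ** U t) + norm (Xi ** \<Delta>X t ** (V t ** Si t))"
        by (metis norm_triangle_ineq)
      also have "\<dots> \<le> norm (Xi ** U t) + norm (Xi ** \<Delta>X t) * norm (V t ** Si t)"
        by (intro add_left_mono frobenius_norm_mult_le)
      finally show ?thesis by (simp add: frobenius_norm_unitary_mult unitary_V)
    qed
  qed
qed

lemma N_bigo: "Oe N"
  unfolding N_def[abs_def]
  by (intro matrix_mult_bigo(2)[OF matrix_mult_bigo(1)] matrix_mult_bigo(1) Si_bigo norm_bigo_ctranspose U_bigo \<Delta>X_bigo unitary_bigo unitary_V)

lemma J_bigo: "Oe J"
  unfolding J_def[abs_def]
  by (intro norm_bigo_add N_bigo matrix_mult_bigo(2)[OF matrix_mult_bigo(1)] Si_bigo G_bigo S_bigo)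

lemma Si_Ustar_X: "Si t ** ctranspose (U t) ** X = (mat 1 + J t) ** ctranspose (V t)"
  unfolding J_def N_def G_def by (rule weighted_factor_identity[OF svd unitary_V Si_S])

lemma Qt_mult_T: "Qt t ** T t = V t ** (mat 1 + ctranspose (J t)) + E t ** Si t"
proof -
  have "ctranspose X ** U t ** Si t = V t ** (mat 1 + ctranspose (J t))"
    using arg_cong[OF Si_Ustar_X, of ctranspose] by (simp add: ctranspose_simps ctranspose_Si matrix_ring)
  then show ?thesis
    by (simp add: T_def matrix_mul_assoc qr matrix_mult_add_rdistrib)
qed

lemma T_bigo: "O1 T"
proof -
  have "T t = ctranspose (Qt t) ** (V t ** (mat 1 + ctranspose (J t)) + E t ** Si t)" for t
    by (simp add: Qt_mult_T[symmetric] matrix_mul_assoc unitary_simps)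
  moreover have "O1 (\<lambda>t. ctranspose (Qt t) ** (V t ** (mat 1 + ctranspose (J t)) + E t ** Si t))"
    by (intro matrix_mult_bigo(1) norm_bigo_add norm_bigo_ctranspose norm_bigo_const unitary_bigo unitary_V
       unitary_Qt bigo_weaken(2)[OF J_bigo] bigo_weaken(2)[OF bigo_weaken(1)[OF E_bigo]] Si_bigo)
  ultimately show ?thesis by presburger
qed

text \<open>
  The unitary \<open>Qt\<close> drops out of $T^*T$, and \<open>Qt_mult_T\<close> leaves $(I + J)(I + J)^*$ up to negligible terms.
\<close>

lemma P_approx: "Og (\<lambda>t. P t - (J t + ctranspose (J t)))"
proof -
  let ?W = "\<lambda>t. V t ** (mat 1 + ctranspose (J t))"
  let ?D = "\<lambda>t. E t ** Si t"
  have "P t - (J t + ctranspose (J t)) =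
      J t ** ctranspose (J t) + ctranspose (?D t) ** ?W t + ctranspose (?W t + ?D t) ** ?D t" for t
  proof -
    have "ctranspose (T t) ** T t = ctranspose (Qt t ** T t) ** (Qt t ** T t)"
      by (simp add: ctranspose_mult matrix_mul_assoc left_cancel[OF unitary_simps(3)])
    also have "\<dots> = ctranspose (?W t) ** ?W t + ctranspose (?D t) ** ?W t + ctranspose (?W t + ?D t) ** ?D t"
      unfolding Qt_mult_T by (simp add: matrix_ring ctranspose_add)
    also have "ctranspose (?W t) ** ?W t = mat 1 + J t + ctranspose (J t) + J t ** ctranspose (J t)"
      by (simp add: matrix_ring ctranspose_simps left_cancel[OF unitary_simps(1)] unitary_simps)
    finally show ?thesis by (simp add: P_def)
  qed
  moreover have D: "Og ?D" by (intro matrix_mult_bigo(2) E_bigo Si_bigo)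
  moreover have W: "O1 ?W"
    by (intro matrix_mult_bigo(1) norm_bigo_add norm_bigo_const norm_bigo_ctranspose unitary_bigo unitary_V bigo_weaken(2)[OF J_bigo])
  have "Og (\<lambda>t. J t ** ctranspose (J t))"
    by (intro matrix_mult_bigo(3) norm_bigo_ctranspose J_bigo)
  moreover have "Og (\<lambda>t. ctranspose (?D t) ** ?W t)"
    by (intro matrix_mult_bigo(2) norm_bigo_ctranspose D W)
  moreover have "Og (\<lambda>t. ctranspose (?W t + ?D t) ** ?D t)"
    by (intro matrix_mult_bigo(1) norm_bigo_ctranspose norm_bigo_add D W bigo_weaken(2)[OF bigo_weaken(1)])
  ultimately show ?thesis by (simp only: norm_bigo_add)
qed

lemma P_bigo: "Oe P"
proof -
  have "Oe (\<lambda>t. (P t - (J t + ctranspose (J t))) + (J t + ctranspose (J t)))"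
    by (intro norm_bigo_add norm_bigo_ctranspose J_bigo bigo_weaken(1)[OF P_approx])
  then show ?thesis by simp
qed

section \<open>Second-order estimates for the triangular factor and the Gram matrix\<close>

lemma T_upper: "j < i \<Longrightarrow> T t $ i $ j = 0"
  using upper_R[of t] by (simp add: T_def Si_eq mult_diag_matrix_nth upper_triangular_def)

text \<open>
  \<open>Q t i j\<close> is the sum that the Cholesky recursion subtracts: for \<open>i \<le> j\<close>, entry \<open>(i, j)\<close> of $T^*T$ without
  the contribution of row \<open>i\<close> of \<open>T\<close>.
\<close>

definition "Q t i j = (\<Sum>k\<in>{k. k < i}. cnj (T t $ k $ i) * T t $ k $ j)"

lemma P_nth: "i \<le> j \<Longrightarrow> P t $ i $ j = Q t i j + cnj (T t $ i $ i) * T t $ i $ j - (if i = j then 1 else 0)"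
proof -
  have "(ctranspose (T t) ** T t) $ i $ j = (\<Sum>k\<in>UNIV. cnj (T t $ k $ i) * T t $ k $ j)"
    by (simp add: matrix_matrix_mult_def)
  also have "\<dots> = (\<Sum>k\<in>insert i {k. k < i}. cnj (T t $ k $ i) * T t $ k $ j)"
    by (rule sum.mono_neutral_right) (auto simp: T_upper)
  also have "\<dots> = Q t i j + cnj (T t $ i $ i) * T t $ i $ j"
    by (simp add: Q_def)
  finally show ?thesis by (simp add: P_def mat_def)
qed

lemma Q_bigo:
  assumes "\<And>k j. k < i \<Longrightarrow> k < j \<Longrightarrow> Oe (\<lambda>t. T t $ k $ j)" "i \<le> j"
  shows "Og (\<lambda>t. Q t i j)"
  unfolding Q_def
proof (intro norm_bigo_sum mult_bigo(3))
  fix k assume "k \<in> {k. k < i}"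
  then have k: "k < i" "k < j" using assms(2) by auto
  have "norm (cnj (T t $ k $ i)) \<le> norm (T t $ k $ i)" for t by simp
  then show "Oe (\<lambda>t. cnj (T t $ k $ i))" by (rule norm_bigo_bound[OF assms(1)[OF k(1) k(1)]])
  show "Oe (\<lambda>t. T t $ k $ j)" using assms(1) k by blast
qed

lemma P_nth_bigo: "Oe (\<lambda>t. P t $ i $ j)"
  by (intro norm_bigo_nth P_bigo)

lemma T_nth_bigo: "O1 (\<lambda>t. T t $ i $ j)"
  by (intro norm_bigo_nth T_bigo)

text \<open>
  The diagonal of \<open>T\<close> is determined only up to unimodular factors, so that only its modulus can be close to \<open>1\<close>.
\<close>

lemma T_diag_square_bigo:
  assumes "Og (\<lambda>t. Q t i i)"
  shows "Oe (\<lambda>t. cnj (T t $ i $ i) * T t $ i $ i - 1)"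
proof -
  have "cnj (T t $ i $ i) * T t $ i $ i - 1 = P t $ i $ i - Q t i i" for t
    using P_nth[of i i t] by simp
  then show ?thesis by (simp only:) (intro norm_bigo_diff P_nth_bigo bigo_weaken(1) assms)
qed

text \<open>
  Solving the recursion for an off-diagonal entry by multiplying with the diagonal entry instead of dividing by its
  conjugate: the price is a last term with a small coefficient, which can be absorbed.
\<close>

lemma T_recursion:
  assumes "i < j"
  shows "T t $ i $ j = T t $ i $ i * (P t $ i $ j - Q t i j) - (cnj (T t $ i $ i) * T t $ i $ i - 1) * T t $ i $ j"
proof -
  have "P t $ i $ j - Q t i j = cnj (T t $ i $ i) * T t $ i $ j"
    using P_nth[of i j t] assms by simp
  then show ?thesis by (simp only:) (simp add: algebra_simps)
qed

text \<open>
  Induction over the rows: by the rows above, the subtracted sums \<open>Q t i j\<close> and \<open>Q t i i\<close> are products of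
  first-order entries, hence negligible.
\<close>

lemma T_offdiag_bigo: "i < j \<Longrightarrow> Oe (\<lambda>t. T t $ i $ j)"
proof (induct "card {k. k < i}" arbitrary: i j rule: less_induct)
  case less
  have IH: "Oe (\<lambda>t. T t $ k $ l)" if "k < i" "k < l" for k l
  proof (rule less.hyps)
    show "card {m. m < k} < card {m. m < i}"
      using that(1) by (intro psubset_card_mono) auto
  qed (rule that(2))
  have Qij: "Og (\<lambda>t. Q t i j)" and Qii: "Og (\<lambda>t. Q t i i)"
    using Q_bigo[of i j] Q_bigo[of i i] IH less.prems by auto
  show ?case
  proof (rule norm_bigo_absorb)
    show "Oe (\<lambda>t. T t $ i $ i * (P t $ i $ j - Q t i j))"
      by (intro mult_bigo(1) T_nth_bigo norm_bigo_diff P_nth_bigo bigo_weaken(1) Qij)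
    show "((\<lambda>t. norm (cnj (T t $ i $ i) * T t $ i $ i - 1)) \<longlongrightarrow> 0) F"
      by (rule norm_bigo_tendsto_0[OF T_diag_square_bigo[OF Qii] e_tendsto])
    show "norm (T t $ i $ j) \<le> norm (T t $ i $ i * (P t $ i $ j - Q t i j))
        + norm (cnj (T t $ i $ i) * T t $ i $ i - 1) * norm (T t $ i $ j)" for t
      unfolding norm_mult[of "_ - 1", symmetric]
      by (subst T_recursion[OF less.prems]) (rule norm_triangle_ineq4)
  qed
qed

lemma Q_bigo_all: "i \<le> j \<Longrightarrow> Og (\<lambda>t. Q t i j)"
  by (rule Q_bigo) (auto intro: T_offdiag_bigo)

lemma T_diag_bigo: "Oe (\<lambda>t. norm (T t $ i $ i) - 1)"
proof (rule norm_bigo_bound)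
  show "Oe (\<lambda>t. cnj (T t $ i $ i) * T t $ i $ i - 1)"
    by (rule T_diag_square_bigo) (rule Q_bigo_all, simp)
  show "norm (norm (T t $ i $ i) - 1) \<le> norm (cnj (T t $ i $ i) * T t $ i $ i - 1)" for t
  proof -
    let ?n = "norm (T t $ i $ i)"
    have "cnj (T t $ i $ i) * T t $ i $ i - 1 = complex_of_real (?n\<^sup>2 - 1)"
      using complex_norm_square[of "T t $ i $ i"] by (simp add: mult.commute)
    then have "norm (cnj (T t $ i $ i) * T t $ i $ i - 1) = \<bar>?n\<^sup>2 - 1\<bar>"
      by (simp only: norm_of_real)
    also have "\<dots> = \<bar>?n - 1\<bar> * (?n + 1)"
    proof -
      have "?n\<^sup>2 - 1 = (?n - 1) * (?n + 1)" by (simp add: power2_eq_square algebra_simps)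
      then show ?thesis by (simp add: abs_mult)
    qed
    finally show ?thesis by (simp add: mult_le_cancel_left1)
  qed
qed

text \<open>
  With the first-order bound for all entries above the diagonal at hand, both the subtracted sum and the defect of
  the diagonal entry become negligible in the recursion.
\<close>

lemma T_second_order:
  assumes "i < j"
  shows "Og (\<lambda>t. T t $ i $ j - T t $ i $ i * P t $ i $ j)"
proof -
  have "T t $ i $ j - T t $ i $ i * P t $ i $ j =
     - (T t $ i $ i * Q t i j + (cnj (T t $ i $ i) * T t $ i $ i - 1) * T t $ i $ j)" for t
    using T_recursion[OF assms, of t] by (simp add: algebra_simps)
  moreover have "Og (\<lambda>t. - (T t $ i $ i * Q t i j + (cnj (T t $ i $ i) * T t $ i $ i - 1) * T t $ i $ j))"
    using assms by (intro norm_bigo_minus norm_bigo_add mult_bigo(1)[OF T_nth_bigo] mult_bigo(3) T_diag_square_bigo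
        Q_bigo_all T_offdiag_bigo) auto
  ultimately show ?thesis by presburger
qed

lemma L_eq: "L t = Si t ** T t ** S t"
  by (simp add: L_def T_def matrix_mul_assoc left_cancel[OF Si_S])

lemma L_nth: "L t $ i $ j = complex_of_real (s t j / s t i) * T t $ i $ j"
  unfolding L_eq by (simp add: Si_eq S_eq diag_matrix_mult_nth mult_diag_matrix_nth)

lemma L_bigo: "O1 L"
  unfolding L_eq[abs_def] by (intro matrix_mult_bigo(1) Si_bigo T_bigo S_bigo)

text \<open>
  The descending order of \<open>S\<close> enters here: scaling from the left does not amplify entries above the diagonal.
\<close>

lemma ratio_bounds: "i \<le> j \<Longrightarrow> 0 \<le> s t j / s t i \<and> s t j / s t i \<le> 1"
  using s_pos[of t i] s_pos[of t j] s_antimono[of i j t] by simp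

text \<open>
  The diagonal part of \<open>L\<close>, which is also that of \<open>T\<close>.
\<close>

definition "A t = diag_matrix (\<lambda>i. T t $ i $ i)"

lemma A_bigo: "O1 A"
proof (intro norm_bigo_vecI)
  show "O1 (\<lambda>t. A t $ i $ j)" for i j
    by (rule norm_bigo_bound[OF T_nth_bigo[of i j]]) (simp add: A_def diag_matrix_nth)
qed

lemma L_minus_A_bigo: "Oe (\<lambda>t. L t - A t)"
proof (intro norm_bigo_vecI)
  fix i j :: 'n
  consider "i < j" | "j < i" | "i = j" by (rule linorder_cases)
  then show "Oe (\<lambda>t. (L t - A t) $ i $ j)"
  proof cases
    assume "i < j"
    show ?thesis
    proof (rule norm_bigo_bound[OF T_offdiag_bigo[OF \<open>i < j\<close>]])
      show "norm ((L t - A t) $ i $ j) \<le> norm (T t $ i $ j)" for t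
      proof -
        have "norm (L t $ i $ j) = s t j / s t i * norm (T t $ i $ j)"
          unfolding L_nth norm_mult norm_of_real using ratio_bounds[of i j t] \<open>i < j\<close> by (subst abs_of_nonneg) auto
        also have "\<dots> \<le> norm (T t $ i $ j)"
          by (rule mult_left_le_one_le) (use ratio_bounds[of i j t] \<open>i < j\<close> in auto)
        finally show ?thesis using \<open>i < j\<close> by (simp add: A_def diag_matrix_nth)
      qed
    qed
  next
    assume "j < i"
    then have "(L t - A t) $ i $ j = 0" for t by (simp add: L_nth A_def diag_matrix_nth T_upper)
    then show ?thesis by (simp only: norm_bigo_zero)
  next
    assume "i = j"
    then have "(L t - A t) $ i $ j = 0" for t
      using s_pos[of t j] by (simp add: L_nth A_def diag_matrix_nth)
    then show ?thesis by (simp only: norm_bigo_zero)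
  qed
qed

lemma H_U: "H t ** (ctranspose (U t) ** U t) = mat 1"
proof -
  have "invertible (ctranspose (U t) ** U t)"
    using gram_less_1 by (rule invertible_of_norm_diff_mat_1)
  then show ?thesis
    unfolding H_def invertible_def matrix_inv_def by (rule someI2_ex) blast
qed

text \<open>
  \<open>U\<close> is square, so the left inverse $H U^*$ is also a right inverse. This allows inserting \<open>U\<close> between $X Q_t$ and
  its conjugate transpose.
\<close>

lemma U_H_Ustar: "U t ** H t ** ctranspose (U t) = mat 1"
proof -
  have "H t ** ctranspose (U t) ** U t = mat 1"
    using H_U by (simp add: matrix_mul_assoc)
  then have "U t ** (H t ** ctranspose (U t)) = mat 1"
    by (simp add: matrix_left_right_inverse)
  then show ?thesis by (simp add: matrix_mul_assoc)
qed

lemma H_eq: "H t = mat 1 - H t ** G t"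
  using H_U[of t] by (simp add: gram_U matrix_ring eq_diff_eq)

lemma H_bigo: "O1 H"
proof (rule norm_bigo_absorb)
  show "O1 (\<lambda>_. mat 1 :: 'n::{finite,linorder} cmatrix)" by (rule norm_bigo_const)
  show "((\<lambda>t. norm (G t)) \<longlongrightarrow> 0) F" by (rule norm_bigo_tendsto_0[OF G_bigo e_tendsto])
  show "norm (H t) \<le> norm (mat 1 :: 'n::{finite,linorder} cmatrix) + norm (G t) * norm (H t)" for t
  proof -
    have "norm (H t) \<le> norm (mat 1 :: 'n::{finite,linorder} cmatrix) + norm (H t ** G t)"
      by (subst H_eq) (rule norm_triangle_ineq4)
    then show ?thesis using frobenius_norm_mult_le[of "H t" "G t"] by (simp add: mult.commute)
  qed
qed

lemma H_second_order: "Og (\<lambda>t. H t - (mat 1 - G t))"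
proof -
  have "H t - (mat 1 - G t) = H t ** G t ** G t" for t
  proof -
    have "H t ** G t + H t ** G t ** G t = G t"
      using arg_cong[OF H_eq[of t], of "\<lambda>A. A ** G t"] by (simp only: matrix_ring matrix_mul_lid eq_diff_eq)
    moreover have "H t - (mat 1 - G t) = G t - H t ** G t" by (subst H_eq) simp
    ultimately show ?thesis by (metis add_diff_cancel_left')
  qed
  moreover have "Og (\<lambda>t. H t ** G t ** G t)"
    by (intro matrix_mult_bigo(3) matrix_mult_bigo(1)[OF H_bigo] G_bigo)
  ultimately show ?thesis by presburger
qed

text \<open>
  By \<open>U_H_Ustar\<close>, $(X Q_t)^* X Q_t = (U^* X Q_t)^* H\, (U^* X Q_t)$, and the equation for the QR factors identifies
  $U^* X Q_t$ with $R^*$ up to negligible terms.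
\<close>

lemma M_approx: "Og (\<lambda>t. M t - L t ** H t ** ctranspose (L t))"
proof -
  let ?Z = "\<lambda>t. X ** Qt t"
  let ?D = "\<lambda>t. Si t ** ctranspose (Qt t) ** E t"
  have Si_Z_H: "ctranspose (?Z t ** Si t) ** (?Z t ** Si t) = (L t - ?D t) ** H t ** ctranspose (L t - ?D t)" for t
  proof -
    have "Si t ** ctranspose (?Z t) ** U t = L t - ?D t"
    proof -
      have "ctranspose X ** U t = Qt t ** R t - E t" by (simp add: qr)
      then have "ctranspose (?Z t) ** U t = R t - ctranspose (Qt t) ** E t"
        by (simp add: ctranspose_mult matrix_mul_assoc[symmetric])
           (simp add: matrix_ring unitary_simps)
      then have "Si t ** (ctranspose (?Z t) ** U t) = Si t ** (R t - ctranspose (Qt t) ** E t)" by simp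
      then show ?thesis by (simp add: L_def matrix_ring)
    qed
    note LD = this[symmetric]
    have "ctranspose (?Z t ** Si t) ** (?Z t ** Si t) = Si t ** ctranspose (?Z t) ** (U t ** H t ** ctranspose (U t)) ** ?Z t ** Si t"
      by (simp add: U_H_Ustar ctranspose_mult ctranspose_Si matrix_mul_assoc)
    also have "\<dots> = (L t - ?D t) ** H t ** ctranspose (L t - ?D t)"
      unfolding LD by (simp add: ctranspose_mult ctranspose_Si matrix_mul_assoc)
    finally show ?thesis .
  qed
  let ?K = "\<lambda>t. E' t ** Si t"
  let ?W = "\<lambda>t. ?Z t ** Si t"
  have "M t - L t ** H t ** ctranspose (L t) =
     ctranspose (?K t) ** (?W t + ?K t) + ctranspose (?W t) ** ?K t
     - ?D t ** (H t ** ctranspose (L t - ?D t)) - L t ** H t ** ctranspose (?D t)" for t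
  proof -
    have "M t = ctranspose (?W t + ?K t) ** (?W t + ?K t)"
      by (simp add: M_def Y ctranspose_simps ctranspose_Si matrix_ring)
    also have "\<dots> = ctranspose (?W t) ** ?W t + ctranspose (?K t) ** (?W t + ?K t) + ctranspose (?W t) ** ?K t"
      by (simp only: ctranspose_add matrix_add_ldistrib matrix_mult_add_rdistrib add_ac)
    finally show ?thesis unfolding Si_Z_H by (simp add: ctranspose_diff matrix_ring)
  qed
  moreover have K: "Og ?K" by (intro matrix_mult_bigo(2) E'_bigo Si_bigo)
  moreover have W: "O1 ?W" by (intro matrix_mult_bigo(1) norm_bigo_const unitary_bigo unitary_Qt Si_bigo)
  moreover have D: "Og ?D"
    by (intro matrix_mult_bigo(1) norm_bigo_ctranspose unitary_bigo unitary_Qt Si_bigo E_bigo)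
  have "Og (\<lambda>t. ctranspose (?K t) ** (?W t + ?K t))"
    by (intro matrix_mult_bigo(2) norm_bigo_ctranspose norm_bigo_add K W bigo_weaken(2)[OF bigo_weaken(1)[OF K]])
  moreover have "Og (\<lambda>t. ctranspose (?W t) ** ?K t)"
    by (intro matrix_mult_bigo(1) norm_bigo_ctranspose K W)
  moreover have "Og (\<lambda>t. ?D t ** (H t ** ctranspose (L t - ?D t)))"
    by (rule matrix_mult_bigo(2)[OF D], rule matrix_mult_bigo(1)[OF H_bigo],
        intro norm_bigo_ctranspose norm_bigo_diff L_bigo bigo_weaken(2)[OF bigo_weaken(1)[OF D]])
  moreover have "Og (\<lambda>t. L t ** H t ** ctranspose (?D t))"
    by (rule matrix_mult_bigo(1)[OF _ norm_bigo_ctranspose[OF D]], intro matrix_mult_bigo(1) L_bigo H_bigo)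
  ultimately show ?thesis by (simp only: norm_bigo_add norm_bigo_diff)
qed

text \<open>
  Expansion around the diagonal part \<open>A\<close> of \<open>L\<close> and around the identity: products of two of the first-order matrices
  \<open>L - A\<close> and \<open>G\<close> are negligible.
\<close>

lemma LHL_approx:
  "Og (\<lambda>t. L t ** H t ** ctranspose (L t) -
     (A t ** ctranspose (A t) + A t ** ctranspose (L t - A t) + (L t - A t) ** ctranspose (A t)
       - A t ** G t ** ctranspose (A t)))"
proof -
  let ?C = "\<lambda>t. L t - A t"
  let ?K = "\<lambda>t. H t - (mat 1 - G t)"
  have "L t ** H t ** ctranspose (L t) -
     (A t ** ctranspose (A t) + A t ** ctranspose (?C t) + ?C t ** ctranspose (A t)
       - A t ** G t ** ctranspose (A t)) =
     ?C t ** ctranspose (?C t) - A t ** (G t ** ctranspose (?C t)) - ?C t ** G t ** ctranspose (L t)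
     + L t ** ?K t ** ctranspose (L t)" (is "?l t = ?r t") for t
    by (simp add: ctranspose_diff matrix_ring)
  moreover have "Og ?r"
  proof (intro norm_bigo_add norm_bigo_diff)
    note C = L_minus_A_bigo
    show "Og (\<lambda>t. ?C t ** ctranspose (?C t))"
      by (intro matrix_mult_bigo(3) norm_bigo_ctranspose C)
    show "Og (\<lambda>t. A t ** (G t ** ctranspose (?C t)))"
      by (rule matrix_mult_bigo(1)[OF A_bigo], intro matrix_mult_bigo(3) norm_bigo_ctranspose C G_bigo)
    show "Og (\<lambda>t. ?C t ** G t ** ctranspose (L t))"
      by (rule matrix_mult_bigo(2)[OF _ norm_bigo_ctranspose[OF L_bigo]], intro matrix_mult_bigo(3) C G_bigo)
    show "Og (\<lambda>t. L t ** ?K t ** ctranspose (L t))"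
      by (rule matrix_mult_bigo(2)[OF _ norm_bigo_ctranspose[OF L_bigo]])
         (rule matrix_mult_bigo(1)[OF L_bigo H_second_order])
  qed
  ultimately show ?thesis by presburger
qed

text \<open>
  The leading term of \<open>M\<close> above the diagonal. The coefficient of \<open>G\<close> is what remains of
  \<open>q * (q + 1 / q) - 1\<close> with \<open>q = s t j / s t i\<close>: a potentially large \<open>1 / q\<close> from $T^*T$ is damped to \<open>1\<close> and
  cancelled by the contribution of $(U^*U)^{-1}$.
\<close>

definition "leading t i j = (s t j / s t i)\<^sup>2 *\<^sub>R (G t $ i $ j) + (s t j / s t i) *\<^sub>R (N t $ i $ j + cnj (N t $ j $ i))"

text \<open>
  For \<open>i < j\<close>, the products with the diagonal matrix \<open>A\<close> in \<open>LHL_approx\<close> leave only one entry of \<open>L\<close> and one of \<open>G\<close>,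
  because \<open>L\<close> vanishes below the diagonal. Inserting \<open>T_second_order\<close> and then \<open>P_approx\<close> gives the leading term.
\<close>

lemma M_nth_approx:
  assumes "i < j"
  shows "Og (\<lambda>t. M t $ i $ j - T t $ i $ i * cnj (T t $ j $ j) * leading t i j)"
proof -
  let ?a = "\<lambda>t. T t $ i $ i" and ?b = "\<lambda>t. cnj (T t $ j $ j)" and ?q = "\<lambda>t. complex_of_real (s t j / s t i)"
  let ?D1 = "\<lambda>t. M t - L t ** H t ** ctranspose (L t)"
  let ?D2 = "\<lambda>t. L t ** H t ** ctranspose (L t) -
     (A t ** ctranspose (A t) + A t ** ctranspose (L t - A t) + (L t - A t) ** ctranspose (A t)
       - A t ** G t ** ctranspose (A t))"
  let ?D3 = "\<lambda>t. P t - (J t + ctranspose (J t))"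
  have eq: "M t $ i $ j - ?a t * ?b t * leading t i j =
    ?D1 t $ i $ j + ?D2 t $ i $ j + ?q t * ?b t * (T t $ i $ j - ?a t * P t $ i $ j)
     + ?q t * (?a t * ?b t) * ?D3 t $ i $ j" for t
  proof -
    have m: "leading t i j = ?q t * (?q t * G t $ i $ j + N t $ i $ j + cnj (N t $ j $ i))"
      by (simp add: leading_def scaleR_conv_of_real power2_eq_square algebra_simps)
    have D2: "?D2 t $ i $ j = (L t ** H t ** ctranspose (L t)) $ i $ j - (?q t * T t $ i $ j * ?b t - ?a t * G t $ i $ j * ?b t)"
      using assms unfolding A_def ctranspose_diag_matrix
      by (simp add: diag_matrix_mult_nth mult_diag_matrix_nth diag_matrix_nth L_nth T_upper)
    have "cnj (G t $ j $ i) = G t $ i $ j"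
      using arg_cong[OF ctranspose_G[of t], of "\<lambda>A. A $ i $ j"] by simp
    then have D3: "?D3 t $ i $ j = P t $ i $ j - (?q t * G t $ i $ j + N t $ i $ j + G t $ i $ j / ?q t + cnj (N t $ j $ i))"
      by (simp add: J_def Si_eq S_eq diag_matrix_mult_nth mult_diag_matrix_nth)
    have "?q t \<noteq> 0" using s_pos[of t i] s_pos[of t j] by simp
    then show ?thesis unfolding m D2 D3 by (simp add: field_simps)
  qed
  have q: "O1 ?q"
    by (rule norm_bigo_bound[OF norm_bigo_const[of F "1::real"]]) (use ratio_bounds[of i j] assms in \<open>simp del: of_real_divide abs_divide\<close>)
  have b: "O1 ?b"
    by (rule norm_bigo_bound[OF T_nth_bigo[of j j]]) simp
  have "Og (\<lambda>t. ?D1 t $ i $ j + ?D2 t $ i $ j + ?q t * ?b t * (T t $ i $ j - ?a t * P t $ i $ j)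
     + ?q t * (?a t * ?b t) * ?D3 t $ i $ j)"
    by (intro norm_bigo_add norm_bigo_nth M_approx LHL_approx mult_bigo(1)[OF mult_bigo(1)[OF q b] T_second_order[OF assms]]
        mult_bigo(1)[OF mult_bigo(1)[OF q mult_bigo(1)[OF T_nth_bigo b]]] P_approx)
  then show ?thesis unfolding eq .
qed

lemma cmod_leading_le:
  assumes "i < j"
  shows "cmod (leading t i j) \<le> cmod (G t $ i $ j) + cmod (N t $ i $ j) + cmod (N t $ j $ i)"
proof -
  define q where "q = s t j / s t i"
  have q: "0 \<le> q" "q \<le> 1" using ratio_bounds[of i j t] assms by (simp_all add: q_def)
  have "cmod (leading t i j) \<le> cmod (q\<^sup>2 *\<^sub>R (G t $ i $ j)) + cmod (q *\<^sub>R (N t $ i $ j + cnj (N t $ j $ i)))"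
    unfolding leading_def q_def by (rule norm_triangle_ineq)
  also have "\<dots> \<le> cmod (G t $ i $ j) + cmod (N t $ i $ j + cnj (N t $ j $ i))"
    using q by (intro add_mono) (simp_all add: mult_left_le_one_le power_le_one)
  also have "\<dots> \<le> cmod (G t $ i $ j) + (cmod (N t $ i $ j) + cmod (cnj (N t $ j $ i)))"
    by (intro add_left_mono norm_triangle_ineq)
  finally show ?thesis by simp
qed

lemma leading_bigo:
  assumes "i < j"
  shows "Oe (\<lambda>t. leading t i j)"
proof (rule norm_bigo_bound)
  show "Oe (\<lambda>t. cmod (G t $ i $ j) + cmod (N t $ i $ j) + cmod (N t $ j $ i))"
    by (intro norm_bigo_add iffD2[OF norm_bigo_norm] norm_bigo_nth G_bigo N_bigo)
  show "norm (leading t i j) \<le> norm (cmod (G t $ i $ j) + cmod (N t $ i $ j) + cmod (N t $ j $ i))" for t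
    unfolding real_norm_def by (rule order_trans[OF cmod_leading_le[OF assms] abs_ge_self])
qed

text \<open>
  The factor of the leading term has modulus \<open>1 + O(e)\<close>. As the leading term is itself of first order, replacing the
  factor by \<open>1\<close> costs a negligible amount.
\<close>

lemma M_nth_bound_upper:
  assumes "i < j"
  shows "\<exists>r :: 'a \<Rightarrow> real. Og r \<and>
    (\<forall>t. cmod (M t $ i $ j) \<le> cmod (G t $ i $ j) + cmod (N t $ i $ j) + cmod (N t $ j $ i) + r t)"
proof -
  let ?a = "\<lambda>t. T t $ i $ i" and ?b = "\<lambda>t. T t $ j $ j"
  let ?d = "\<lambda>t. (cmod (?a t) - 1) * cmod (?b t) + (cmod (?b t) - 1)"
  let ?r = "\<lambda>t. cmod (M t $ i $ j - ?a t * cnj (?b t) * leading t i j) + ?d t * cmod (leading t i j)"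
  have d: "Oe ?d"
    by (intro norm_bigo_add mult_bigo(2)[OF T_diag_bigo] T_diag_bigo iffD2[OF norm_bigo_norm] T_nth_bigo)
  have "Og ?r"
  proof (rule norm_bigo_add)
    show "Og (\<lambda>t. cmod (M t $ i $ j - ?a t * cnj (?b t) * leading t i j))"
      by (intro iffD2[OF norm_bigo_norm] M_nth_approx[OF assms])
    show "Og (\<lambda>t. ?d t * cmod (leading t i j))"
      by (rule mult_bigo(3)[OF d]) (intro iffD2[OF norm_bigo_norm] leading_bigo[OF assms])
  qed
  moreover have "cmod (M t $ i $ j) \<le> cmod (G t $ i $ j) + cmod (N t $ i $ j) + cmod (N t $ j $ i) + ?r t" for t
  proof -
    have "cmod (M t $ i $ j) \<le> cmod (M t $ i $ j - ?a t * cnj (?b t) * leading t i j) + cmod (?a t * cnj (?b t) * leading t i j)"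
      using norm_triangle_ineq[of "M t $ i $ j - ?a t * cnj (?b t) * leading t i j" "?a t * cnj (?b t) * leading t i j"] by simp
    also have "cmod (?a t * cnj (?b t) * leading t i j) = cmod (leading t i j) + ?d t * cmod (leading t i j)"
      by (simp add: norm_mult algebra_simps)
    finally show ?thesis using cmod_leading_le[OF assms, of t] by linarith
  qed
  ultimately show ?thesis by blast
qed

lemma M_nth_bound:
  assumes "i \<noteq> j"
  shows "\<exists>r :: 'a \<Rightarrow> real. Og r \<and>
    (\<forall>t. cmod (M t $ i $ j) \<le> cmod (G t $ i $ j) + cmod (N t $ i $ j) + cmod (N t $ j $ i) + r t)"
proof (cases "i < j")
  case True
  then show ?thesis by (rule M_nth_bound_upper)
next
  case False
  with assms have "j < i" by simp
  have "ctranspose (M t) = M t" for t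
    by (simp add: M_def ctranspose_mult ctranspose_Si matrix_mul_assoc)
  then have "cmod (M t $ i $ j) = cmod (M t $ j $ i)" for t
    by (metis ctranspose_nth complex_mod_cnj)
  moreover have "cmod (G t $ i $ j) = cmod (G t $ j $ i)" for t
    by (metis ctranspose_G ctranspose_nth complex_mod_cnj)
  ultimately show ?thesis
    using M_nth_bound_upper[OF \<open>j < i\<close>] by (simp add: add_ac)
qed

theorem off_M_bound: "\<exists>r :: 'a \<Rightarrow> real. Og r \<and> (\<forall>t. off (M t) \<le> norm (G t) + 2 * norm (N t) + r t)"
proof -
  have "\<forall>i j. \<exists>r :: 'a \<Rightarrow> real. i \<noteq> j \<longrightarrow> Og r \<and>
    (\<forall>t. cmod (M t $ i $ j) \<le> cmod (G t $ i $ j) + cmod (N t $ i $ j) + cmod (N t $ j $ i) + r t)"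
    using M_nth_bound by blast
  then obtain r where r: "\<And>i j. i \<noteq> j \<Longrightarrow> Og (r i j :: 'a \<Rightarrow> real)"
    "\<And>i j t. i \<noteq> j \<Longrightarrow> cmod (M t $ i $ j) \<le> cmod (G t $ i $ j) + cmod (N t $ i $ j) + cmod (N t $ j $ i) + r i j t"
    unfolding choice_iff by blast
  define D where "D t = (\<chi> i j. if i = j then 0 else r i j t)" for t
  have "Og (\<lambda>t. norm (D t))"
    unfolding norm_bigo_norm
  proof (intro norm_bigo_vecI)
    show "Og (\<lambda>t. D t $ i $ j)" for i j
      using r(1)[of i j] by (cases "i = j") (simp_all add: D_def norm_bigo_zero)
  qed
  moreover have "off (M t) \<le> norm (G t) + 2 * norm (N t) + norm (D t)" for t
    by (rule off_le_of_entries) (simp add: D_def r(2))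
  ultimately show ?thesis by blast
qed

end

section \<open>From the rounding error model to a uniform estimate\<close>

text \<open>
  The hypotheses on one instance of the computed quantities, bundled so that they can be instantiated for whole
  sequences. The accuracy functions are those for the fixed dimension \<open>CARD('n)\<close>.
\<close>

definition lowprec_model ::
  "'n::{finite,linorder} cmatrix \<Rightarrow> (real \<Rightarrow> real) \<Rightarrow> (real \<Rightarrow> real) \<Rightarrow> (real \<Rightarrow> real) \<Rightarrow> (real \<Rightarrow> real)
    \<Rightarrow> real \<Rightarrow> real \<Rightarrow> 'n cmatrix \<Rightarrow> 'n cmatrix \<Rightarrow> 'n cmatrix \<Rightarrow> 'n cmatrix \<Rightarrow> 'n cmatrix \<Rightarrow> 'n cmatrix
    \<Rightarrow> 'n cmatrix \<Rightarrow> 'n cmatrix \<Rightarrow> 'n cmatrix \<Rightarrow> 'n cmatrix \<Rightarrow> 'n cmatrix \<Rightarrow> 'n cmatrix \<Rightarrow> bool"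
  where "lowprec_model X \<epsilon>SVD \<epsilon>U \<epsilon>qr \<epsilon>Q u ulow U S V \<Delta>X B \<Delta>XU \<Delta>B Qt Q R Y \<Delta>XQ \<longleftrightarrow>
    (let n = CARD('n) in
      0 < u \<and> u \<le> ulow \<and> real n * u < 1 \<and>
      0 \<le> \<epsilon>SVD ulow \<and> 0 \<le> \<epsilon>U ulow \<and> \<epsilon>U ulow < 1 \<and> 0 \<le> \<epsilon>qr u \<and> 0 \<le> \<epsilon>Q u \<and>
      unitary V \<and> unitary Qt \<and> upper_triangular R \<and>
      diagonal_pos_descending S \<and>
      X = U ** S ** ctranspose V + \<Delta>X \<and>
      frobenius_norm \<Delta>X \<le> \<epsilon>SVD ulow * frobenius_norm X \<and>
      frobenius_norm (ctranspose U ** U - mat 1) \<le> \<epsilon>U ulow \<and>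
      B = ctranspose X ** U + \<Delta>XU \<and>
      frobenius_norm \<Delta>XU \<le> sqrt n * gamma_roundoff n u * spectral_norm U * frobenius_norm X \<and>
      B + \<Delta>B = Qt ** R \<and>
      frobenius_norm \<Delta>B \<le> \<epsilon>qr u * frobenius_norm B \<and>
      frobenius_norm (Q - Qt) \<le> \<epsilon>Q u \<and>
      Y = X ** Q + \<Delta>XQ \<and>
      frobenius_norm \<Delta>XQ \<le> sqrt n * gamma_roundoff n u * spectral_norm Q * frobenius_norm X \<and>
      \<epsilon>U ulow * spectral_norm S * spectral_norm (matrix_inv S)
        + sqrt n * (\<epsilon>SVD ulow + sqrt n * gamma_roundoff n u + \<epsilon>qr u
                      + sqrt n * gamma_roundoff n u * \<epsilon>qr u)
            * (1 + \<epsilon>U ulow) * spectral_norm X * spectral_norm (matrix_inv S)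
        < sqrt (3 / 2) - 1)"

lemma gamma_roundoff_bigo: "gamma_roundoff n \<in> O[at_right 0](\<lambda>t. t)"
proof (rule bigoI)
  have "((\<lambda>t. 1 - real n * t) \<longlongrightarrow> 1 - real n * 0) (at_right 0)"
    by (intro tendsto_intros)
  then have "eventually (\<lambda>t. 1/2 < 1 - real n * t) (at_right 0)"
    by (rule order_tendstoD(1)) simp
  moreover have "eventually (\<lambda>t. (0::real) < t) (at_right 0)"
    by (rule eventually_at_right_less)
  ultimately show "eventually (\<lambda>t. norm (gamma_roundoff n t) \<le> (2 * real n) * norm t) (at_right 0)"
  proof eventually_elim
    case (elim t)
    then have "gamma_roundoff n t \<le> real n * t / (1/2)"
      unfolding gamma_roundoff_def by (intro divide_left_mono) auto
    moreover have "0 \<le> gamma_roundoff n t"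
      unfolding gamma_roundoff_def using elim by simp
    ultimately show ?case using elim by simp
  qed
qed

text \<open>
  Reduction of the rounding error model to backward errors: \<open>\<Delta>XU + \<Delta>B\<close> is the error of the QR
  factorization of the exact product, and \<open>X (Q - Qt) + \<Delta>XQ\<close> that of the final product with the exactly unitary
  factor. Both are \<open>O(u)\<close> because all matrices involved stay bounded.
\<close>

lemma lowprec_model_asymptotics:
  fixes X :: "'n::{finite,linorder} cmatrix"
  assumes "invertible X"
    and O: "\<epsilon>SVD \<in> O[at_right 0](\<lambda>t. t)" "\<epsilon>U \<in> O[at_right 0](\<lambda>t. t)"
      "\<epsilon>qr \<in> O[at_right 0](\<lambda>t. t)" "\<epsilon>Q \<in> O[at_right 0](\<lambda>t. t)"
    and model: "\<And>k::'a. lowprec_model X \<epsilon>SVD \<epsilon>U \<epsilon>qr \<epsilon>Q (u k) (ulow k) (U k) (S k) (V k) (\<Delta>X k) (B k)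
       (\<Delta>XU k) (\<Delta>B k) (Qt k) (Q k) (R k) (Y k) (\<Delta>XQ k)"
    and ulow: "(ulow \<longlongrightarrow> 0) F"
  shows "\<exists>E E'. perturbed_svd F ulow (\<lambda>k. u k + (ulow k)\<^sup>2) X U S V \<Delta>X R E Qt Y E'"
proof -
  let ?n = "CARD('n)"
  let ?\<gamma> = "\<lambda>k. gamma_roundoff ?n (u k)"
  let ?g = "\<lambda>k. u k + (ulow k)\<^sup>2"
  let ?E = "\<lambda>k. \<Delta>XU k + \<Delta>B k" and ?E' = "\<lambda>k. X ** (Q k - Qt k) + \<Delta>XQ k"
  have m: "0 < u k" "u k \<le> ulow k" "real ?n * u k < 1" "\<epsilon>U (ulow k) < 1"
      "unitary (V k)" "unitary (Qt k)" "upper_triangular (R k)" "diagonal_pos_descending (S k)"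
      "X = U k ** S k ** ctranspose (V k) + \<Delta>X k"
      "norm (\<Delta>X k) \<le> \<epsilon>SVD (ulow k) * norm X"
      "norm (ctranspose (U k) ** U k - mat 1) \<le> \<epsilon>U (ulow k)"
      "B k = ctranspose X ** U k + \<Delta>XU k"
      "norm (\<Delta>XU k) \<le> sqrt ?n * ?\<gamma> k * spectral_norm (U k) * norm X"
      "B k + \<Delta>B k = Qt k ** R k"
      "norm (\<Delta>B k) \<le> \<epsilon>qr (u k) * norm (B k)"
      "norm (Q k - Qt k) \<le> \<epsilon>Q (u k)"
      "Y k = X ** Q k + \<Delta>XQ k"
      "norm (\<Delta>XQ k) \<le> sqrt ?n * ?\<gamma> k * spectral_norm (Q k) * norm X" for k
    using model[of k] unfolding lowprec_model_def Let_def by auto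
  have ulow_pos: "0 < ulow k" for k using m(1,2)[of k] by linarith
  have u: "(u \<longlongrightarrow> 0) F"
    by (rule tendsto_sandwich[OF _ _ tendsto_const ulow]) (auto intro!: always_eventually less_imp_le m(1,2))
  have u_right: "filterlim u (at_right 0) F" and ulow_right: "filterlim ulow (at_right 0) F"
    using u ulow m(1) ulow_pos less_imp_neq[OF m(1), symmetric] less_imp_neq[OF ulow_pos, symmetric]
    by (auto simp: filterlim_at intro!: always_eventually)
  have comp_u: "norm_bigo F ?g (\<lambda>k. f (u k))" and comp_u_1: "norm_bigo F (\<lambda>_. 1) (\<lambda>k. f (u k))"
    if "f \<in> O[at_right 0](\<lambda>t. t)" for f :: "real \<Rightarrow> real"
  proof -
    have f: "(\<lambda>k. f (u k)) \<in> O[F](u)"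
      using landau_o.big.compose[OF that u_right] .
    have "u \<in> O[F](?g)"
      by (rule landau_o.big_mono) (use m(1) in \<open>auto intro!: always_eventually simp: less_imp_le\<close>)
    with f show "norm_bigo F ?g (\<lambda>k. f (u k))" unfolding norm_bigo_real by (rule landau_o.big_trans)
    have "u \<in> O[F](\<lambda>_. 1)" by (rule bigoI_tendsto[where c = 0]) (use u in auto)
    with f show "norm_bigo F (\<lambda>_. 1) (\<lambda>k. f (u k))" unfolding norm_bigo_real by (rule landau_o.big_trans)
  qed
  have comp_ulow: "norm_bigo F ulow (\<lambda>k. f (ulow k))" if "f \<in> O[at_right 0](\<lambda>t. t)" for f :: "real \<Rightarrow> real"
    using landau_o.big.compose[OF that ulow_right] unfolding norm_bigo_real .
  have ulow_1: "ulow \<in> O[F](\<lambda>_. 1)" by (rule bigoI_tendsto[where c = 0]) (use ulow in auto)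
  have const: "norm_bigo F h (\<lambda>k. f k * g k)" if "norm_bigo F h f" "norm_bigo F (\<lambda>_. 1) g"
    for h and f g :: "'a \<Rightarrow> real"
    using norm_bigo_mult[OF that] by simp
  have c: "norm_bigo F (\<lambda>_. 1) (\<lambda>_. x)" for x :: real by (rule norm_bigo_const)
  have \<gamma>: "norm_bigo F ?g ?\<gamma>" by (rule comp_u[OF gamma_roundoff_bigo])
  have \<gamma>_nonneg: "0 \<le> ?\<gamma> k" for k
    using m(1,3)[of k] by (simp add: gamma_roundoff_def)
  have U2: "spectral_norm (U k) \<le> 2" for k
    using spectral_norm_le_of_gram[OF m(11)[of k]] m(4)[of k] by linarith
  have U_O: "norm_bigo F (\<lambda>_. 1) U"
  proof (rule norm_bigo_le[OF c])
    show "norm (U k) \<le> sqrt ?n * 2" for k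
      by (rule order_trans[OF frobenius_norm_le_spectral mult_left_mono[OF U2]]) simp
  qed
  have \<Delta>XU: "norm_bigo F ?g \<Delta>XU"
  proof (rule norm_bigo_le)
    show "norm_bigo F ?g (\<lambda>k. ?\<gamma> k * (sqrt ?n * 2 * norm X))" by (rule const[OF \<gamma> c])
    show "norm (\<Delta>XU k) \<le> ?\<gamma> k * (sqrt ?n * 2 * norm X)" for k
    proof -
      have "(sqrt ?n * ?\<gamma> k) * spectral_norm (U k) * norm X \<le> (sqrt ?n * ?\<gamma> k) * 2 * norm X"
        by (intro mult_right_mono mult_left_mono U2) (simp_all add: \<gamma>_nonneg)
      with m(13)[of k] show ?thesis by (simp add: mult_ac)
    qed
  qed
  have g_ulow: "?g \<in> O[F](ulow)"
  proof -
    have "u \<in> O[F](ulow)"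
      by (rule landau_o.big_mono) (use m(1,2) ulow_pos in \<open>auto intro!: always_eventually simp: less_imp_le abs_of_pos\<close>)
    moreover have "(\<lambda>k. (ulow k)\<^sup>2) \<in> O[F](ulow)"
      using landau_o.big.mult[OF landau_o.big_refl ulow_1, of ulow] by (simp add: power2_eq_square)
    ultimately show ?thesis by (rule sum_in_bigo)
  qed
  have g_1: "?g \<in> O[F](\<lambda>_. 1)" using g_ulow ulow_1 by (rule landau_o.big_trans)
  have B_O: "norm_bigo F (\<lambda>_. 1) B"
  proof -
    have "norm_bigo F (\<lambda>_. 1) (\<lambda>k. ctranspose X ** U k + \<Delta>XU k)"
      using norm_bigo_matrix_mult[OF norm_bigo_const[of F "ctranspose X"] U_O]
      by (intro norm_bigo_add norm_bigo_trans[OF \<Delta>XU g_1]) simp_all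
    then show ?thesis unfolding m(12)[symmetric] .
  qed
  have \<Delta>B: "norm_bigo F ?g \<Delta>B"
    by (rule norm_bigo_le[OF const[OF comp_u[OF O(3)] iffD2[OF norm_bigo_norm B_O]] m(15)])
  have QQt: "norm_bigo F ?g (\<lambda>k. Q k - Qt k)"
    by (rule norm_bigo_le[OF comp_u[OF O(4)] m(16)])
  have Q_O: "norm_bigo F (\<lambda>_. 1) Q"
  proof -
    have "norm (Qt k) \<le> norm (mat 1 :: 'n::{finite,linorder} cmatrix)" for k
      using frobenius_norm_unitary_mult[OF m(6)[of k], of "mat 1"] by simp
    then have "norm_bigo F (\<lambda>_. 1) Qt"
      by (rule norm_bigo_bound[OF norm_bigo_const])
    from norm_bigo_add[OF norm_bigo_trans[OF QQt g_1] this] show ?thesis by simp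
  qed
  have \<Delta>XQ: "norm_bigo F ?g \<Delta>XQ"
  proof (rule norm_bigo_le)
    show "norm_bigo F ?g (\<lambda>k. ?\<gamma> k * (norm (Q k) * (sqrt ?n * norm X)))"
      by (rule const[OF \<gamma> const[OF iffD2[OF norm_bigo_norm Q_O] c]])
    show "norm (\<Delta>XQ k) \<le> ?\<gamma> k * (norm (Q k) * (sqrt ?n * norm X))" for k
    proof -
      have "(sqrt ?n * ?\<gamma> k) * spectral_norm (Q k) * norm X \<le> (sqrt ?n * ?\<gamma> k) * norm (Q k) * norm X"
        by (intro mult_right_mono mult_left_mono spectral_norm_le_frobenius_norm) (simp_all add: \<gamma>_nonneg)
      with m(18)[of k] show ?thesis by (simp add: mult_ac)
    qed
  qed
  have "perturbed_svd F ulow ?g X U S V \<Delta>X R ?E Qt Y ?E'"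
  proof
    show "(\<lambda>k. ulow k * ulow k) \<in> O[F](?g)"
      by (rule landau_o.big_mono) (use m(1) in \<open>auto intro!: always_eventually simp: power2_eq_square less_imp_le\<close>)
    show "Qt k ** R k = ctranspose X ** U k + ?E k" for k
      using m(12,14)[of k] by (simp add: add_ac)
    show "Y k = X ** Qt k + ?E' k" for k
      using m(17)[of k] by (simp add: matrix_ring)
    show "norm (ctranspose (U k) ** U k - mat 1) < 1" for k
      using m(4,11)[of k] by linarith
    show "norm_bigo F ulow (\<lambda>k. ctranspose (U k) ** U k - mat 1)"
      by (rule norm_bigo_le[OF comp_ulow[OF O(2)] m(11)])
    show "norm_bigo F ulow \<Delta>X"
      by (rule norm_bigo_le[OF const[OF comp_ulow[OF O(1)] c] m(10)])
    show "norm_bigo F ?g ?E" by (rule norm_bigo_add[OF \<Delta>XU \<Delta>B])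
    show "norm_bigo F ?g ?E'"
      using norm_bigo_matrix_mult[OF norm_bigo_const[of F X] QQt] \<Delta>XQ by (intro norm_bigo_add) simp_all
  qed (use assms(1) m ulow g_ulow in auto)
  then show ?thesis by blast
qed

text \<open>
  The constant \<open>C\<close> is the same for all admissible data. A failure for each \<open>C = k\<close> and \<open>\<delta> = 1 / (k + 1)\<close> would
  give a sequence that contradicts \<open>off_M_bound\<close>. The remainder is stated with the factor
  \<open>spectral_norm X * spectral_norm (matrix_inv S)\<close>, which is bounded below along such a sequence since \<open>S\<close> is
  bounded and \<open>X\<close> is fixed.
\<close>

lemma uniform_off_bound:
  fixes X :: "'n::{finite,linorder} cmatrix"
  assumes X: "invertible X"
    and O: "\<epsilon>SVD \<in> O[at_right 0](\<lambda>t. t)" "\<epsilon>U \<in> O[at_right 0](\<lambda>t. t)"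
      "\<epsilon>qr \<in> O[at_right 0](\<lambda>t. t)" "\<epsilon>Q \<in> O[at_right 0](\<lambda>t. t)"
  shows "\<exists>C \<delta>. 0 < \<delta> \<and> (\<forall>u ulow U S V \<Delta>X B \<Delta>XU \<Delta>B Qt Q R Y \<Delta>XQ.
    lowprec_model X \<epsilon>SVD \<epsilon>U \<epsilon>qr \<epsilon>Q u ulow U S V \<Delta>X B \<Delta>XU \<Delta>B Qt Q R Y \<Delta>XQ \<and> ulow < \<delta> \<longrightarrow>
    off (matrix_inv S ** ctranspose Y ** Y ** matrix_inv S)
      \<le> norm (ctranspose U ** U - mat 1) + 2 * norm (matrix_inv S ** ctranspose U ** \<Delta>X ** V)
        + C * (u + ulow\<^sup>2) * spectral_norm X * spectral_norm (matrix_inv S) \<and>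
    norm (matrix_inv S ** (ctranspose U ** U - mat 1) ** S + matrix_inv S ** ctranspose U ** \<Delta>X ** V) \<le> 1)"
    (is "\<exists>C \<delta>. 0 < \<delta> \<and> (\<forall>u ulow U S V \<Delta>X B \<Delta>XU \<Delta>B Qt Q R Y \<Delta>XQ.
      ?model u ulow U S V \<Delta>X B \<Delta>XU \<Delta>B Qt Q R Y \<Delta>XQ \<and> ulow < \<delta> \<longrightarrow> ?bound C u ulow U S V \<Delta>X Y)")
proof (rule ccontr)
  assume "\<not> ?thesis"
  then have "\<forall>C \<delta>. \<not> 0 < \<delta> \<or> (\<exists>u ulow U S V \<Delta>X B \<Delta>XU \<Delta>B Qt Q R Y \<Delta>XQ.
      ?model u ulow U S V \<Delta>X B \<Delta>XU \<Delta>B Qt Q R Y \<Delta>XQ \<and> ulow < \<delta> \<and> \<not> ?bound C u ulow U S V \<Delta>X Y)"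
    by (simp only: not_ex de_Morgan_conj[of "0 < _"] not_all not_imp conj_assoc simp_thms)
  then have "\<not> 0 < inverse (real (Suc k)) \<or> (\<exists>u ulow U S V \<Delta>X B \<Delta>XU \<Delta>B Qt Q R Y \<Delta>XQ.
      ?model u ulow U S V \<Delta>X B \<Delta>XU \<Delta>B Qt Q R Y \<Delta>XQ \<and> ulow < inverse (real (Suc k)) \<and> \<not> ?bound (real k) u ulow U S V \<Delta>X Y)"
    for k by (elim allE)
  then have "\<forall>k. \<exists>u ulow U S V \<Delta>X B \<Delta>XU \<Delta>B Qt Q R Y \<Delta>XQ.
      ?model u ulow U S V \<Delta>X B \<Delta>XU \<Delta>B Qt Q R Y \<Delta>XQ \<and> ulow < inverse (real (Suc k)) \<and> \<not> ?bound (real k) u ulow U S V \<Delta>X Y"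
    by (simp only: inverse_positive_iff_positive of_nat_0_less_iff zero_less_Suc simp_thms)
  then obtain u ulow U S V \<Delta>X B \<Delta>XU \<Delta>B Qt Q R Y \<Delta>XQ
    where model: "\<And>k::nat. ?model (u k) (ulow k) (U k) (S k) (V k) (\<Delta>X k) (B k) (\<Delta>XU k) (\<Delta>B k) (Qt k) (Q k) (R k) (Y k) (\<Delta>XQ k)"
      and ulow_less: "\<And>k. ulow k < inverse (real (Suc k))"
      and fails: "\<And>k. \<not> ?bound (real k) (u k) (ulow k) (U k) (S k) (V k) (\<Delta>X k) (Y k)"
    unfolding choice_iff by blast
  have u_pos: "0 < u k" and ulow_pos: "0 < ulow k" for k
    using model[of k] unfolding lowprec_model_def Let_def by auto
  have ulow: "ulow \<longlonglongrightarrow> 0"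
    by (rule tendsto_sandwich[OF _ _ tendsto_const LIMSEQ_inverse_real_of_nat])
       (use less_imp_le[OF ulow_pos] less_imp_le[OF ulow_less] in \<open>auto intro!: always_eventually simp del: of_nat_Suc\<close>)
  obtain E E' where "perturbed_svd sequentially ulow (\<lambda>k. u k + (ulow k)\<^sup>2) X U S V \<Delta>X R E Qt Y E'"
    using lowprec_model_asymptotics[OF X O model ulow] by blast
  then interpret perturbed_svd sequentially ulow "\<lambda>k. u k + (ulow k)\<^sup>2" X U S V \<Delta>X R E Qt Y E' .
  obtain r where r: "norm_bigo sequentially (\<lambda>k. u k + (ulow k)\<^sup>2) r"
    and off: "\<And>k. off (M k) \<le> norm (G k) + 2 * norm (N k) + r k"
    using off_M_bound by blast
  obtain c where c: "0 < c" "eventually (\<lambda>k. norm (r k) \<le> c * norm (u k + (ulow k)\<^sup>2)) sequentially"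
    using r unfolding norm_bigo_real by (elim landau_o.bigE)
  obtain d where d: "0 < d" "eventually (\<lambda>k. norm (norm (S k)) \<le> d * norm (1::real)) sequentially"
    using S_bigo unfolding norm_bigo_def by (elim landau_o.bigE)
  have J: "eventually (\<lambda>k. norm (J k) < 1) sequentially"
    by (rule order_tendstoD(2)[OF norm_bigo_tendsto_0[OF J_bigo e_tendsto]]) simp
  let ?x = "spectral_norm X"
  have x: "0 < ?x" by (rule spectral_norm_pos[OF X])
  have "eventually (\<lambda>k. c * d / ?x \<le> real k) sequentially"
    using filterlim_real_sequentially unfolding filterlim_at_top by blast
  with c(2) d(2) J have "eventually (\<lambda>k. False) sequentially"
  proof eventually_elim
    case (elim k)
    let ?g = "u k + (ulow k)\<^sup>2" and ?s = "spectral_norm (matrix_inv (S k))"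
    have g: "0 \<le> ?g" using u_pos[of k] by simp
    have "1 \<le> sqrt (real CARD('n))" by simp
    also have "\<dots> = norm (Si k ** S k)" by (simp add: Si_S frobenius_norm_mat_1)
    also have "\<dots> \<le> ?s * norm (S k)" unfolding Si_def by (rule frobenius_norm_mult_le_spectral)
    also have "\<dots> \<le> ?s * d"
      using elim by (intro mult_left_mono spectral_norm_nonneg) simp
    finally have s: "1 \<le> ?s * d" .
    have "r k \<le> c * ?g * 1" using elim(1) g by simp
    also have "\<dots> \<le> c * ?g * (?s * d)"
      using c(1) g by (intro mult_left_mono s) simp
    also have "\<dots> = (c * d / ?x) * (?g * ?x * ?s)" using x by simp
    also have "\<dots> \<le> real k * (?g * ?x * ?s)"
      using elim(4) g x by (intro mult_right_mono mult_nonneg_nonneg spectral_norm_nonneg) simp_all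
    finally have "off (M k) \<le> norm (G k) + 2 * norm (N k) + real k * ?g * ?x * ?s"
      using off[of k] by (simp add: mult_ac)
    then have "?bound (real k) (u k) (ulow k) (U k) (S k) (V k) (\<Delta>X k) (Y k)"
      using elim(3) unfolding M_def N_def J_def G_def Si_def by simp
    with fails[of k] show False by blast
  qed
  then show False by simp
qed

lemma norm_weighted_residual_le:
  fixes X W :: "complex^'n^'n"
  assumes "unitary V" "frobenius_norm \<Delta>X \<le> \<epsilon>SVD * frobenius_norm X" "0 \<le> \<epsilon>SVD"
    and "frobenius_norm (ctranspose U ** U - mat 1) \<le> \<epsilon>U"
  shows "frobenius_norm (W ** ctranspose U ** \<Delta>X ** V)
    \<le> (1 + \<epsilon>U) * (sqrt (real CARD('n)) * \<epsilon>SVD * spectral_norm X * spectral_norm W)"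
proof -
  have U: "spectral_norm (ctranspose U) \<le> 1 + \<epsilon>U"
    using spectral_norm_ctranspose_le spectral_norm_le_of_gram[OF assms(4)] by (rule order_trans)
  have "norm (W ** ctranspose U ** \<Delta>X ** V) = norm (W ** (ctranspose U ** \<Delta>X))"
    by (simp add: frobenius_norm_mult_unitary assms(1) matrix_mul_assoc)
  also have "\<dots> \<le> spectral_norm W * norm (ctranspose U ** \<Delta>X)"
    by (rule frobenius_norm_mult_le_spectral)
  also have "\<dots> \<le> spectral_norm W * (spectral_norm (ctranspose U) * norm \<Delta>X)"
    by (intro mult_left_mono frobenius_norm_mult_le_spectral spectral_norm_nonneg)
  also have "\<dots> \<le> spectral_norm W * ((1 + \<epsilon>U) * (\<epsilon>SVD * (sqrt (real CARD('n)) * spectral_norm X)))"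
  proof (intro mult_left_mono mult_mono U spectral_norm_nonneg norm_ge_zero)
    show "norm \<Delta>X \<le> \<epsilon>SVD * (sqrt (real CARD('n)) * spectral_norm X)"
      using assms(2) mult_left_mono[OF frobenius_norm_le_spectral[of X] assms(3)] by (rule order_trans)
    show "0 \<le> 1 + \<epsilon>U" using U spectral_norm_nonneg order_trans by blast
  qed
  finally show ?thesis by (simp add: mult_ac)
qed

text \<open>
  The rows of \<open>X\<close> have norms \<open>cmod (d i)\<close>, so the hypothesis on the rows says that \<open>K\<close>, the residual with the
  row scaling \<open>D\<close> divided out, has all rows bounded by \<open>\<epsilon>\<close>. The scaling reappears on the other side as
  \<open>W U^* D\<close>, which \<open>weighted_factor_identity\<close> expresses by the inverse of the well scaled matrix \<open>Z\<close>.
\<close>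

lemma norm_weighted_residual_le_rowwise:
  fixes X :: "complex^'n^'n"
  assumes "X = U ** S ** ctranspose V + \<Delta>X" "unitary V" "W ** S = mat 1" "invertible X"
    and rows: "\<And>i. norm (row i \<Delta>X) \<le> \<epsilon> * norm (row i X)" and "0 \<le> \<epsilon>"
    and Z: "X = D ** Z" "diagonal D" "\<And>i. norm (row i Z) = 1"
  shows "frobenius_norm (W ** ctranspose U ** \<Delta>X ** V)
    \<le> (1 + frobenius_norm (W ** (ctranspose U ** U - mat 1) ** S + W ** ctranspose U ** \<Delta>X ** V))
       * (sqrt (real CARD('n)) * \<epsilon> * spectral_norm (matrix_inv Z))"
proof -
  let ?J = "W ** (ctranspose U ** U - mat 1) ** S + W ** ctranspose U ** \<Delta>X ** V"
  define d where "d i = D $ i $ i" for i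
  have D: "D = diag_matrix d"
    using Z(2) by (simp add: vec_eq_iff diag_matrix_nth diagonal_def d_def)
  obtain Xi where Xi: "X ** Xi = mat 1" "Xi ** X = mat 1"
    using assms(4) unfolding invertible_def by blast
  have "Xi ** D ** Z = mat 1" using Xi(2) Z(1) by (simp add: matrix_mul_assoc)
  then have "Z ** matrix_inv Z = mat 1"
    using someI_ex[of "\<lambda>A'. Z ** A' = mat 1 \<and> A' ** Z = mat 1"] matrix_left_right_inverse
    unfolding matrix_inv_def by blast
  have row_eq: "row i A = A $ i" for i and A :: "complex^'n^'n"
    by (simp add: row_def vec_eq_iff)
  have d0: "d i \<noteq> 0" for i
  proof -
    have "(D ** (Z ** Xi)) $ i $ i = 1"
      using Xi(1) Z(1) by (simp add: matrix_mul_assoc mat_def)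
    then show ?thesis by (auto simp: D diag_matrix_mult_nth)
  qed
  have norm_scaled_row: "norm ((diag_matrix a ** A) $ i) = cmod (a i) * norm (A $ i)"
    for a i and A :: "complex^'n^'n"
  proof -
    have "(norm ((diag_matrix a ** A) $ i))\<^sup>2 = (cmod (a i) * norm (A $ i))\<^sup>2"
      by (simp add: power2_norm_vec diag_matrix_mult_nth norm_mult power_mult_distrib sum_distrib_left)
    then show ?thesis by (simp add: power2_eq_iff_nonneg)
  qed
  define K where "K = diag_matrix (\<lambda>i. 1 / d i) ** \<Delta>X"
  have "D ** K = \<Delta>X"
    by (simp add: D K_def vec_eq_iff diag_matrix_mult_nth d0)
  have "norm (K $ i) \<le> \<epsilon>" for i
  proof -
    have "norm (X $ i) = cmod (d i)"
      using Z(3)[of i] by (simp add: Z(1) D norm_scaled_row row_eq)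
    then have "norm (\<Delta>X $ i) \<le> \<epsilon> * cmod (d i)" using rows[of i] by (simp add: row_eq)
    then show ?thesis using d0[of i] by (simp add: K_def norm_scaled_row norm_divide divide_le_eq)
  qed
  then have "(norm K)\<^sup>2 \<le> (\<Sum>i\<in>(UNIV::'n set). \<epsilon>\<^sup>2)"
    unfolding power2_norm_vec[of K] by (intro sum_mono power_mono) simp_all
  also have "\<dots> = (sqrt (real CARD('n)) * \<epsilon>)\<^sup>2" by (simp add: power_mult_distrib)
  finally have K: "norm K \<le> sqrt (real CARD('n)) * \<epsilon>"
    using assms(6) by (simp add: abs_le_square_iff[symmetric])
  have "W ** ctranspose U ** D = W ** ctranspose U ** (D ** (Z ** matrix_inv Z))"
    by (simp add: \<open>Z ** matrix_inv Z = mat 1\<close>)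
  also have "\<dots> = W ** ctranspose U ** X ** matrix_inv Z"
    by (simp add: Z(1) matrix_mul_assoc)
  also have "\<dots> = (mat 1 + ?J) ** ctranspose V ** matrix_inv Z"
    by (subst weighted_factor_identity[OF assms(1-3)]) simp
  finally have WUD: "W ** ctranspose U ** D = (mat 1 + ?J) ** ctranspose V ** matrix_inv Z" .
  let ?L = "ctranspose V ** (matrix_inv Z ** K)"
  have "norm (W ** ctranspose U ** \<Delta>X ** V) = norm (W ** ctranspose U ** D ** K)"
    unfolding frobenius_norm_mult_unitary[OF assms(2)]
    by (simp only: \<open>D ** K = \<Delta>X\<close> matrix_mul_assoc[symmetric])
  also have "W ** ctranspose U ** D ** K = ?L + ?J ** ?L"
    unfolding WUD by (simp add: matrix_mult_add_rdistrib matrix_mul_assoc)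
  also have "norm (?L + ?J ** ?L) \<le> norm ?L + norm ?J * norm ?L"
    by (intro order_trans[OF norm_triangle_ineq] add_left_mono frobenius_norm_mult_le)
  also have "\<dots> = (1 + norm ?J) * norm (matrix_inv Z ** K)"
    by (simp add: frobenius_norm_unitary_mult unitary_ctranspose assms(2) algebra_simps)
  also have "\<dots> \<le> (1 + norm ?J) * (spectral_norm (matrix_inv Z) * (sqrt (real CARD('n)) * \<epsilon>))"
    by (intro mult_left_mono order_trans[OF frobenius_norm_mult_le_spectral] K spectral_norm_nonneg) simp
  finally show ?thesis by (simp add: mult_ac)
qed

text \<open>
  Of the smallness condition only the term \<open>n * \<gamma> * spectral_norm X * spectral_norm (matrix_inv S)\<close> is
  retained. It bounds one of the two factors \<open>matrix_inv S\<close>; the other one stays in the estimate. The resulting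
  coefficient depends on \<open>u\<close> alone and need not be small.
\<close>

lemma crude_off_bound:
  fixes X :: "'n::{finite,linorder} cmatrix"
  assumes X: "invertible X"
    and model: "lowprec_model X \<epsilon>SVD \<epsilon>U \<epsilon>qr \<epsilon>Q u ulow U S V \<Delta>X B \<Delta>XU \<Delta>B Qt Q R Y \<Delta>XQ"
  defines "\<gamma> \<equiv> gamma_roundoff CARD('n) u" and "n \<equiv> real CARD('n)"
  shows "off (matrix_inv S ** ctranspose Y ** Y ** matrix_inv S)
    \<le> (frobenius_norm X * (sqrt n + \<epsilon>Q u) * (1 + sqrt n * \<gamma>))\<^sup>2 / (\<gamma> * (spectral_norm X)\<^sup>2)
        * spectral_norm X * spectral_norm (matrix_inv S)"
proof -
  have m: "0 < u" "n * u < 1" "0 \<le> \<epsilon>SVD ulow" "0 \<le> \<epsilon>U ulow" "0 \<le> \<epsilon>qr u" "0 \<le> \<epsilon>Q u"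
      "unitary Qt" "diagonal_pos_descending S" "norm (Q - Qt) \<le> \<epsilon>Q u" "Y = X ** Q + \<Delta>XQ"
      "norm \<Delta>XQ \<le> sqrt n * \<gamma> * spectral_norm Q * norm X"
    and small: "\<epsilon>U ulow * spectral_norm S * spectral_norm (matrix_inv S)
        + sqrt n * (\<epsilon>SVD ulow + sqrt n * \<gamma> + \<epsilon>qr u + sqrt n * \<gamma> * \<epsilon>qr u)
            * (1 + \<epsilon>U ulow) * spectral_norm X * spectral_norm (matrix_inv S) < sqrt (3 / 2) - 1"
    using model unfolding lowprec_model_def Let_def \<gamma>_def n_def by auto
  let ?x = "spectral_norm X" and ?\<sigma> = "spectral_norm (matrix_inv S)"
  let ?y = "norm X * (sqrt n + \<epsilon>Q u) * (1 + sqrt n * \<gamma>)"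
  have x: "0 < ?x" by (rule spectral_norm_pos[OF X])
  have \<sigma>: "0 \<le> ?\<sigma>" by (rule spectral_norm_nonneg)
  have n: "0 < n" by (simp add: n_def)
  have \<gamma>: "0 < \<gamma>" using m(1,2) n by (simp add: \<gamma>_def n_def gamma_roundoff_def)
  have \<sigma>_bound: "n * \<gamma> * ?x * ?\<sigma> \<le> 1"
  proof -
    have "n * \<gamma> * ?x * ?\<sigma> = sqrt n * (sqrt n * \<gamma>) * 1 * ?x * ?\<sigma>"
      using n by simp
    also have "\<dots> \<le> sqrt n * (\<epsilon>SVD ulow + sqrt n * \<gamma> + \<epsilon>qr u + sqrt n * \<gamma> * \<epsilon>qr u) * (1 + \<epsilon>U ulow) * ?x * ?\<sigma>"
      using m(3-6) n \<gamma> x \<sigma> by (intro mult_right_mono mult_mono) simp_all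
    also have "\<dots> \<le> sqrt (3 / 2) - 1"
    proof -
      have "0 \<le> \<epsilon>U ulow * spectral_norm S * ?\<sigma>"
        by (intro mult_nonneg_nonneg m(4) spectral_norm_nonneg)
      with small show ?thesis by linarith
    qed
    also have "\<dots> \<le> 1"
    proof -
      have "sqrt (3 / 2) \<le> sqrt (2\<^sup>2)" by (intro real_sqrt_le_mono) simp
      then show ?thesis by simp
    qed
    finally show ?thesis .
  qed
  have Q: "norm Q \<le> sqrt n + \<epsilon>Q u"
  proof -
    have "norm Qt = sqrt n"
      using frobenius_norm_unitary_mult[OF m(7), of "mat 1"] by (simp add: frobenius_norm_mat_1 n_def)
    then show ?thesis using norm_triangle_ineq[of "Q - Qt" Qt] m(9) by simp
  qed
  have "norm Y \<le> norm X * norm Q + sqrt n * \<gamma> * norm Q * norm X"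
  proof -
    have "norm \<Delta>XQ \<le> sqrt n * \<gamma> * norm Q * norm X"
      using n \<gamma> by (intro order_trans[OF m(11)] mult_right_mono mult_left_mono spectral_norm_le_frobenius_norm) simp_all
    then show ?thesis unfolding m(10)
      by (intro order_trans[OF norm_triangle_ineq] add_mono frobenius_norm_mult_le)
  qed
  also have "\<dots> = norm X * norm Q * (1 + sqrt n * \<gamma>)" by (simp add: algebra_simps)
  also have "\<dots> \<le> ?y"
    using n \<gamma> by (intro mult_right_mono mult_left_mono Q) simp_all
  finally have Y: "norm Y \<le> ?y" .
  have Si: "norm (matrix_inv S) \<le> sqrt n * ?\<sigma>" unfolding n_def by (rule frobenius_norm_le_spectral)
  have "off (matrix_inv S ** ctranspose Y ** Y ** matrix_inv S) \<le> norm (matrix_inv S ** ctranspose Y ** Y ** matrix_inv S)"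
    by (rule off_le_frobenius_norm)
  also have "\<dots> \<le> norm (matrix_inv S) * norm Y * norm Y * norm (matrix_inv S)"
    by (intro order_trans[OF frobenius_norm_mult_le] mult_right_mono) (simp_all add: order_trans[OF frobenius_norm_mult_le] mult_mono)
  also have "\<dots> \<le> (sqrt n * ?\<sigma>) * ?y * ?y * (sqrt n * ?\<sigma>)"
    using n \<gamma> \<sigma> m(6) by (intro mult_mono Si Y) simp_all
  also have "\<dots> = (n * \<gamma> * ?x * ?\<sigma>) * (?y\<^sup>2 / (\<gamma> * ?x\<^sup>2) * ?x * ?\<sigma>)"
  proof -
    have "(a * ?\<sigma>) * y * y * (a * ?\<sigma>) = (a\<^sup>2 * \<gamma> * ?x * ?\<sigma>) * (y\<^sup>2 / (\<gamma> * ?x\<^sup>2) * ?x * ?\<sigma>)" for a y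
      using \<gamma> x by (simp add: power2_eq_square)
    from this[of "sqrt n" ?y] show ?thesis using n by simp
  qed
  also have "\<dots> \<le> 1 * (?y\<^sup>2 / (\<gamma> * ?x\<^sup>2) * ?x * ?\<sigma>)"
    using \<gamma> x \<sigma> by (intro mult_right_mono \<sigma>_bound) simp
  finally show ?thesis by simp
qed

text \<open>
  The perturbation theory yields the coefficients on the left: \<open>1\<close> for the loss of orthogonality, and \<open>4 * (1 + a)\<close>,
  an upper bound for both versions of the residual term.
\<close>

lemma coefficient_bounds:
  fixes a y :: real
  assumes "0 \<le> a" "a < 1" "0 \<le> y"
  defines "K \<equiv> 2 * (sqrt 2 + sqrt 3)"
  shows "a \<le> (K + 3) / (1 - a) * a" and "4 * (1 + a) * y \<le> K * (1 + a) / (1 - a) * y"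
proof -
  \<comment> \<open>Both square roots are at least 1.\<close>
  have "2 * (1 + 1) \<le> K" unfolding K_def by (intro mult_left_mono add_mono) simp_all
  then have K: "4 \<le> K" by simp
  have "1 \<le> (K + 3) / (1 - a)" using K assms(1,2) by simp
  from mult_right_mono[OF this assms(1)] show "a \<le> (K + 3) / (1 - a) * a" by simp
  have "4 * (1 + a) \<le> K * (1 + a) / 1"
    using mult_right_mono[OF K, of "1 + a"] assms(1) by simp
  also have "\<dots> \<le> K * (1 + a) / (1 - a)" using K assms(1,2) by (intro divide_left_mono) simp_all
  finally show "4 * (1 + a) * y \<le> K * (1 + a) / (1 - a) * y" using assms(3) by (rule mult_right_mono)
qed

theorem theorem1:
  fixes X :: "complex^'n::{finite,linorder}^'n::{finite,linorder}"
    and \<epsilon>SVD \<epsilon>U \<epsilon>qr \<epsilon>Q :: "nat \<Rightarrow> real \<Rightarrow> real"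
    and n :: nat
  assumes "n = CARD('n)"
    and "invertible X"
    and "\<epsilon>SVD n \<in> O[at_right 0](\<lambda>t. t)"
    and "\<epsilon>U n \<in> O[at_right 0](\<lambda>t. t)"
    and "\<epsilon>qr n \<in> O[at_right 0](\<lambda>t. t)"
    and "\<epsilon>Q n \<in> O[at_right 0](\<lambda>t. t)"
  shows "\<exists>r\<^sub>1 r\<^sub>2 :: real \<times> real \<Rightarrow> real.
    r\<^sub>1 \<in> O[at_right 0 \<times>\<^sub>F at_right 0](\<lambda>(u, ulow). u + ulow\<^sup>2) \<and>
    r\<^sub>2 \<in> O[at_right 0 \<times>\<^sub>F at_right 0](\<lambda>(u, ulow). u + ulow\<^sup>2) \<and>
    (\<forall>(u::real) (ulow::real) U S V \<Delta>X B \<Delta>XU \<Delta>B Qt Q R Y \<Delta>XQ.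
      0 < u \<and> u \<le> ulow \<and> real n * u < 1 \<and>
      0 \<le> \<epsilon>SVD n ulow \<and> 0 \<le> \<epsilon>U n ulow \<and> \<epsilon>U n ulow < 1 \<and> 0 \<le> \<epsilon>qr n u \<and> 0 \<le> \<epsilon>Q n u \<and>
      unitary V \<and> unitary Qt \<and> upper_triangular R \<and>
      diagonal_pos_descending S \<and>
      X = U ** S ** ctranspose V + \<Delta>X \<and>
      frobenius_norm \<Delta>X \<le> \<epsilon>SVD n ulow * frobenius_norm X \<and>
      frobenius_norm (ctranspose U ** U - mat 1) \<le> \<epsilon>U n ulow \<and>
      B = ctranspose X ** U + \<Delta>XU \<and>
      frobenius_norm \<Delta>XU \<le> sqrt n * gamma_roundoff n u * spectral_norm U * frobenius_norm X \<and>
      B + \<Delta>B = Qt ** R \<and>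
      frobenius_norm \<Delta>B \<le> \<epsilon>qr n u * frobenius_norm B \<and>
      frobenius_norm (Q - Qt) \<le> \<epsilon>Q n u \<and>
      Y = X ** Q + \<Delta>XQ \<and>
      frobenius_norm \<Delta>XQ \<le> sqrt n * gamma_roundoff n u * spectral_norm Q * frobenius_norm X \<and>
      \<epsilon>U n ulow * spectral_norm S * spectral_norm (matrix_inv S)
        + sqrt n * (\<epsilon>SVD n ulow + sqrt n * gamma_roundoff n u + \<epsilon>qr n u
                      + sqrt n * gamma_roundoff n u * \<epsilon>qr n u)
            * (1 + \<epsilon>U n ulow) * spectral_norm X * spectral_norm (matrix_inv S)
        < sqrt (3 / 2) - 1
      \<longrightarrow>
      off (matrix_inv S ** ctranspose Y ** Y ** matrix_inv S)
        \<le> (2 * (sqrt 2 + sqrt 3) + 3) / (1 - \<epsilon>U n ulow) * \<epsilon>U n ulow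
          + 2 * (sqrt 2 + sqrt 3) * (1 + \<epsilon>U n ulow) / (1 - \<epsilon>U n ulow)
              * sqrt n * \<epsilon>SVD n ulow * spectral_norm X * spectral_norm (matrix_inv S)
          + r\<^sub>1 (u, ulow) * spectral_norm X * spectral_norm (matrix_inv S) \<and>
      ((\<forall>i. norm (row i \<Delta>X) \<le> \<epsilon>SVD n ulow * norm (row i X)) \<longrightarrow>
       (\<forall>D Z.
         X = D ** Z \<and> diagonal D \<and> (\<forall>i. norm (row i Z) = 1) \<longrightarrow>
         off (matrix_inv S ** ctranspose Y ** Y ** matrix_inv S)
           \<le> (2 * (sqrt 2 + sqrt 3) + 3) / (1 - \<epsilon>U n ulow) * \<epsilon>U n ulow
             + 2 * (sqrt 2 + sqrt 3) * (1 + \<epsilon>U n ulow) / (1 - \<epsilon>U n ulow)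
                 * sqrt n * \<epsilon>SVD n ulow * spectral_norm (matrix_inv Z)
             + r\<^sub>2 (u, ulow) * spectral_norm X * spectral_norm (matrix_inv S))))"
proof -
  have n: "n = CARD('n)" by (rule assms(1))
  obtain C \<delta> where \<delta>: "0 < \<delta>" and small: "\<And>u ulow U S V \<Delta>X B \<Delta>XU \<Delta>B Qt Q R Y \<Delta>XQ.
    lowprec_model X (\<epsilon>SVD n) (\<epsilon>U n) (\<epsilon>qr n) (\<epsilon>Q n) u ulow U S V \<Delta>X B \<Delta>XU \<Delta>B Qt Q R Y \<Delta>XQ \<Longrightarrow> ulow < \<delta> \<Longrightarrow>
    off (matrix_inv S ** ctranspose Y ** Y ** matrix_inv S)
      \<le> norm (ctranspose U ** U - mat 1) + 2 * norm (matrix_inv S ** ctranspose U ** \<Delta>X ** V)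
        + C * (u + ulow\<^sup>2) * spectral_norm X * spectral_norm (matrix_inv S) \<and>
    norm (matrix_inv S ** (ctranspose U ** U - mat 1) ** S + matrix_inv S ** ctranspose U ** \<Delta>X ** V) \<le> 1"
    using uniform_off_bound[OF assms(2-6)] by (elim exE conjE) (rule that, assumption, (erule allE)+, erule mp, erule (1) conjI)
  \<comment> \<open>The remainder: asymptotic below the threshold, and the crude coefficient above it.\<close>
  define D where "D u = (frobenius_norm X * (sqrt n + \<epsilon>Q n u) * (1 + sqrt n * gamma_roundoff n u))\<^sup>2
      / (gamma_roundoff n u * (spectral_norm X)\<^sup>2)" for u
  define r where "r p = (case p of (u, ulow) \<Rightarrow> if ulow < \<delta> then C * (u + ulow\<^sup>2) else D u)" for p
  have r_bigo: "r \<in> O[at_right 0 \<times>\<^sub>F at_right 0](\<lambda>(u, ulow). u + ulow\<^sup>2)"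
  proof (rule bigoI[of _ "\<bar>C\<bar>"])
    have "eventually (\<lambda>ulow. ulow < \<delta>) (at_right 0)"
      using \<delta> by (rule order_tendstoD(2)[OF tendsto_ident_at])
    then have "eventually (\<lambda>p. snd p < \<delta>) (at_right (0::real) \<times>\<^sub>F at_right 0)"
      using filterlim_snd by (rule eventually_compose_filterlim)
    then show "eventually (\<lambda>p. norm (r p) \<le> \<bar>C\<bar> * norm (case p of (u, ulow) \<Rightarrow> u + ulow\<^sup>2)) (at_right 0 \<times>\<^sub>F at_right 0)"
      by eventually_elim (auto simp: r_def abs_mult)
  qed
  let ?K = "2 * (sqrt 2 + sqrt 3)"
  have bound: "off (matrix_inv S ** ctranspose Y ** Y ** matrix_inv S)
      \<le> (?K + 3) / (1 - \<epsilon>U n ulow) * \<epsilon>U n ulow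
        + ?K * (1 + \<epsilon>U n ulow) / (1 - \<epsilon>U n ulow) * (sqrt n * \<epsilon>SVD n ulow * \<kappa>)
        + r (u, ulow) * spectral_norm X * spectral_norm (matrix_inv S)"
    if model: "lowprec_model X (\<epsilon>SVD n) (\<epsilon>U n) (\<epsilon>qr n) (\<epsilon>Q n) u ulow U S V \<Delta>X B \<Delta>XU \<Delta>B Qt Q R Y \<Delta>XQ"
      and "0 \<le> \<kappa>"
      and N: "norm (matrix_inv S ** (ctranspose U ** U - mat 1) ** S + matrix_inv S ** ctranspose U ** \<Delta>X ** V) \<le> 1 \<Longrightarrow>
        norm (matrix_inv S ** ctranspose U ** \<Delta>X ** V) \<le> 2 * (1 + \<epsilon>U n ulow) * (sqrt n * \<epsilon>SVD n ulow * \<kappa>)"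
    for u ulow \<kappa> and U S V \<Delta>X B \<Delta>XU \<Delta>B Qt Q R Y \<Delta>XQ :: "'n cmatrix"
  proof -
    let ?a = "\<epsilon>U n ulow" and ?y = "sqrt n * \<epsilon>SVD n ulow * \<kappa>"
    have m: "0 \<le> ?a" "?a < 1" "0 \<le> \<epsilon>SVD n ulow" "norm (ctranspose U ** U - mat 1) \<le> ?a"
      using model unfolding lowprec_model_def Let_def by auto
    have y: "0 \<le> ?y" using m(3) \<open>0 \<le> \<kappa>\<close> by simp
    note coeff = coefficient_bounds[OF m(1,2) y]
    show ?thesis
    proof (cases "ulow < \<delta>")
      case True
      note small = small[OF model True]
      have "2 * norm (matrix_inv S ** ctranspose U ** \<Delta>X ** V) \<le> 4 * (1 + ?a) * ?y"
        using N[OF conjunct2[OF small]] by (simp only: mult.assoc)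
      with conjunct1[OF small] m(4) coeff show ?thesis
        unfolding r_def using True by simp
    next
      case False
      have "0 \<le> 4 * (1 + ?a) * ?y" using m(1) y by simp
      with crude_off_bound[OF assms(2) model] m(1) coeff False show ?thesis
        unfolding r_def D_def n by simp
    qed
  qed
  show ?thesis
  proof (intro exI[of _ r] conjI r_bigo allI impI, goal_cases)
    case (1 u ulow U S V \<Delta>X B \<Delta>XU \<Delta>B Qt Q R Y \<Delta>XQ)
    then have model: "lowprec_model X (\<epsilon>SVD n) (\<epsilon>U n) (\<epsilon>qr n) (\<epsilon>Q n) u ulow U S V \<Delta>X B \<Delta>XU \<Delta>B Qt Q R Y \<Delta>XQ"
      unfolding lowprec_model_def Let_def n .
    let ?\<kappa> = "spectral_norm X * spectral_norm (matrix_inv S)"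
    have \<kappa>: "0 \<le> ?\<kappa>" by (intro mult_nonneg_nonneg spectral_norm_nonneg)
    have m: "0 \<le> \<epsilon>U n ulow" "0 \<le> \<epsilon>SVD n ulow" using 1 by auto
    have "norm (matrix_inv S ** ctranspose U ** \<Delta>X ** V)
        \<le> (1 + \<epsilon>U n ulow) * (sqrt (real CARD('n)) * \<epsilon>SVD n ulow * spectral_norm X * spectral_norm (matrix_inv S))"
      using 1 by (intro norm_weighted_residual_le) auto
    also have "\<dots> = (1 + \<epsilon>U n ulow) * (sqrt n * \<epsilon>SVD n ulow * ?\<kappa>)"
      by (simp add: n mult.assoc)
    also have "\<dots> \<le> 2 * (1 + \<epsilon>U n ulow) * (sqrt n * \<epsilon>SVD n ulow * ?\<kappa>)"
      using m by (intro mult_right_mono mult_nonneg_nonneg \<kappa>) simp_all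
    finally show ?case
      using bound[OF model \<kappa>] by (simp add: mult.assoc)
  next
    case (2 u ulow U S V \<Delta>X B \<Delta>XU \<Delta>B Qt Q R Y \<Delta>XQ D Z)
    then have model: "lowprec_model X (\<epsilon>SVD n) (\<epsilon>U n) (\<epsilon>qr n) (\<epsilon>Q n) u ulow U S V \<Delta>X B \<Delta>XU \<Delta>B Qt Q R Y \<Delta>XQ"
      unfolding lowprec_model_def Let_def n by blast
    let ?J = "matrix_inv S ** (ctranspose U ** U - mat 1) ** S + matrix_inv S ** ctranspose U ** \<Delta>X ** V"
    let ?\<kappa> = "spectral_norm (matrix_inv Z)"
    have m: "0 \<le> \<epsilon>U n ulow" "0 \<le> \<epsilon>SVD n ulow" using 2(1) by auto
    have S: "diagonal_pos_descending S" using 2(1) by blast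
    have "matrix_inv S ** S = mat 1"
      by (rule diagonal_pos_descending_cases[OF S])
    then have N: "norm (matrix_inv S ** ctranspose U ** \<Delta>X ** V)
        \<le> (1 + norm ?J) * (sqrt (real CARD('n)) * \<epsilon>SVD n ulow * ?\<kappa>)"
      using 2 assms(2) by (intro norm_weighted_residual_le_rowwise[where D = D and X = X]) blast+
    have "norm (matrix_inv S ** ctranspose U ** \<Delta>X ** V)
        \<le> 2 * (1 + \<epsilon>U n ulow) * (sqrt n * \<epsilon>SVD n ulow * ?\<kappa>)" if "norm ?J \<le> 1"
    proof (rule order_trans[OF N])
      show "(1 + norm ?J) * (sqrt (real CARD('n)) * \<epsilon>SVD n ulow * ?\<kappa>)
          \<le> 2 * (1 + \<epsilon>U n ulow) * (sqrt n * \<epsilon>SVD n ulow * ?\<kappa>)"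
        unfolding n[symmetric] using m that
        by (intro mult_right_mono mult_nonneg_nonneg spectral_norm_nonneg) simp_all
    qed
    from bound[OF model spectral_norm_nonneg this] show ?case by (simp add: mult.assoc)
  qed
qed

end
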